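(* Let $A$ be a symmetric positive definite $n\times n$ matrix, and let $\{u^{\varepsilon}\}_{\varepsilon>0}$ be a family of smooth solutions on $\mathbb{R}\times[0,T]$ of $$\partial_t u+\partial_x F(u)=G(u)+\varepsilon(Au_{xx}-u_{tt}),\qquad u\in\mathbb{R}^n,$$ such that each $u^{\varepsilon}$ decays fast at infinity. Assume: (1) (Entropy) there are $\eta,q:\mathbb{R}^n\to\mathbb{R}$ and $\alpha,\beta>0$ with $\eta$ strictly convex, $\mathrm{D}\eta(u)\,\mathrm{D}F(u)=\mathrm{D}q(u)$, $\beta I\le \mathrm{D}^2\eta(u)\le\tfrac12\alpha I$ for all $u\in\mathbb{R}^n$, $\eta(u)\ge\eta(0)=0$ and $\mathrm{D}\eta(0)=0$; (2) (Subcharacteristic condition) for this $\alpha$ there is $\nu>0$ with $\tfrac12\big(A\,\mathrm{D}^2\eta(u)+\mathrm{D}^2\eta(u)A\big)-\alpha\,\mathrm{D}F(u)^{\top}\mathrm{D}F(u)\ge\nu I$ for all $u\in\mathbb{R}^n$; (3) (Weak dissipation) $-\big(\mathrm{D}\eta(u)-\mathrm{D}\eta(\bar u)\big)\big(G(u)-G(\bar u)\big)\ge0$ for all $u,\bar u\in\mathbb{R}^n$; (4) (Source potential) there are $R:\mathbb{R}^n\to\mathbb{R}$ and a constant $C_R$ with $G(u)=-\mathrm{D}R(u)^{\top}$, $R(u)\ge R(0)=0$, $\mathrm{D}R(0)=0$, and $|\mathrm{D}R(u)|=|G(u)|\le C_R(1+R(u))$ for all $u\in\mathbb{R}^n$.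 Let $$\varphi(t)=\int_{\mathbb{R}}|u^{\varepsilon}|^2+\varepsilon^2|u^{\varepsilon}_x|^2+\varepsilon^2|u^{\varepsilon}_t|^2\,dx .$$ Then for all $t\in[0,T]$ $$\varphi(t)+\varepsilon\int_{\mathbb{R}}R(u^{\varepsilon}(x,t))\,dx+\int_0^t\!\int_{\mathbb{R}}|\mathrm{D}\eta(u^{\varepsilon})G(u^{\varepsilon})|\,dx\,dt\le C\Big(\varphi(0)+\varepsilon\int_{\mathbb{R}}R(u^{\varepsilon}(x,0))\,dx\Big)$$ with a constant $C=C(A,\alpha,\beta)>0$ independent of both $\varepsilon$ and $T$.
   Context: $F,G:\mathbb{R}^n\to\mathbb{R}^n$ are column-vector valued, $F$ (and $\eta,q$) smooth, $G$ continuous with $G(0)=0$. $\mathrm{D}$ is the differential with respect to $u\in\mathbb{R}^n$, acting as a row operation; so $\mathrm{D}\eta$, $\mathrm{D}R$ are row vectors, $\mathrm{D}F$ is the Jacobian, $\mathrm{D}^2\eta$ the Hessian. Matrix inequalities are in the sense of quadratic forms. "Decays fast at infinity" means: $u^{\varepsilon}$ and its derivatives tend to $0$ as $|x|\to\infty$, uniformly for $t\in[0,T]$, rapidly enough that all integrals over $\mathbb{R}$ that occur are finite and may be differentiated in $t$, and that boundary terms from integration in $x$ vanish. *)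

theory Defs
  imports "HOL-Analysis.Analysis"
begin

section \<open>Smooth maps, differentials, matrix inequalities\<close>

text \<open>Derivatives are taken within \<open>S\<close>. The definition is used for \<open>S = UNIV\<close> and for the closed
  strip \<open>UNIV \<times> {0..T}\<close> with \<open>T > 0\<close>. Both are convex with nonempty interior, so the derivative
  within \<open>S\<close> is unique and \<^const>\<open>frechet_derivative\<close> is not an arbitrary choice; on the strip it is
  one-sided at \<open>t = 0\<close> and \<open>t = T\<close>.\<close>

primrec C_k_on ::
    "nat \<Rightarrow> ('a::real_normed_vector \<Rightarrow> 'b::real_normed_vector) \<Rightarrow> 'a set \<Rightarrow> bool" where
  "C_k_on 0 f S \<longleftrightarrow> continuous_on S f"
| "C_k_on (Suc k) f S \<longleftrightarrow>
     f differentiable_on S \<and> (\<forall>v. C_k_on k (\<lambda>x. frechet_derivative f (at x within S) v) S)"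

definition smooth_on :: "('a::real_normed_vector \<Rightarrow> 'b::real_normed_vector) \<Rightarrow> 'a set \<Rightarrow> bool" where
  "smooth_on f S \<longleftrightarrow> (\<forall>k. C_k_on k f S)"

text \<open>The row vector \<open>D f(u)\<close> of a scalar function and the Hessian \<open>D\<^sup>2 f(u)\<close>. Rows and columns share
  the type \<open>real ^ 'n\<close>: a row times a matrix is \<open>v*\<close>, a row times a column is the inner product.\<close>

definition grad :: "(real ^ 'n \<Rightarrow> real) \<Rightarrow> real ^ 'n \<Rightarrow> real ^ 'n" where
  "grad f u = (\<chi> i. frechet_derivative f (at u) (axis i 1))"

definition hess :: "(real ^ 'n \<Rightarrow> real) \<Rightarrow> real ^ 'n \<Rightarrow> real ^ 'n ^ 'n" where
  "hess f u = jacobian (grad f) (at u)"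

definition qform_le :: "real ^ 'n ^ 'n \<Rightarrow> real ^ 'n ^ 'n \<Rightarrow> bool" (infix \<open>\<sqsubseteq>\<^sub>q\<close> 50) where
  "M \<sqsubseteq>\<^sub>q N \<longleftrightarrow> (\<forall>v. v \<bullet> (M *v v) \<le> v \<bullet> (N *v v))"

definition sym_pos_def :: "real ^ 'n ^ 'n \<Rightarrow> bool" where
  "sym_pos_def A \<longleftrightarrow> transpose A = A \<and> (\<forall>v. v \<noteq> 0 \<longrightarrow> v \<bullet> (A *v v) > 0)"

definition strictly_convex :: "('a::real_vector \<Rightarrow> real) \<Rightarrow> bool" where
  "strictly_convex f \<longleftrightarrow>
     (\<forall>u v s. u \<noteq> v \<longrightarrow> 0 < s \<longrightarrow> s < 1 \<longrightarrow>
        f ((1 - s) *\<^sub>R u + s *\<^sub>R v) < (1 - s) * f u + s * f v)"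

section \<open>Structural assumptions\<close>

definition entropy_pair ::
    "real \<Rightarrow> real \<Rightarrow> (real ^ 'n \<Rightarrow> real ^ 'n) \<Rightarrow> (real ^ 'n \<Rightarrow> real) \<Rightarrow> (real ^ 'n \<Rightarrow> real) \<Rightarrow> bool" where
  "entropy_pair \<alpha> \<beta> F \<eta> q \<longleftrightarrow>
     smooth_on \<eta> UNIV \<and> smooth_on q UNIV \<and> strictly_convex \<eta> \<and>
     (\<forall>u. grad \<eta> u v* jacobian F (at u) = grad q u) \<and>
     (\<forall>u. mat \<beta> \<sqsubseteq>\<^sub>q hess \<eta> u \<and> hess \<eta> u \<sqsubseteq>\<^sub>q mat (\<alpha> / 2)) \<and>
     (\<forall>u. \<eta> u \<ge> \<eta> 0) \<and> \<eta> 0 = 0 \<and> grad \<eta> 0 = 0"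

definition subcharacteristic ::
    "real ^ 'n ^ 'n \<Rightarrow> real \<Rightarrow> real \<Rightarrow> (real ^ 'n \<Rightarrow> real ^ 'n) \<Rightarrow> (real ^ 'n \<Rightarrow> real) \<Rightarrow> bool" where
  "subcharacteristic A \<alpha> \<nu> F \<eta> \<longleftrightarrow>
     (\<forall>u. mat \<nu> \<sqsubseteq>\<^sub>q
        (1/2) *\<^sub>R (A ** hess \<eta> u + hess \<eta> u ** A)
          - \<alpha> *\<^sub>R (transpose (jacobian F (at u)) ** jacobian F (at u)))"

definition weakly_dissipative ::
    "(real ^ 'n \<Rightarrow> real ^ 'n) \<Rightarrow> (real ^ 'n \<Rightarrow> real) \<Rightarrow> bool" where
  "weakly_dissipative G \<eta> \<longleftrightarrow>
     (\<forall>u u'. - ((grad \<eta> u - grad \<eta> u') \<bullet> (G u - G u')) \<ge> 0)"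

definition source_potential ::
    "real \<Rightarrow> (real ^ 'n \<Rightarrow> real ^ 'n) \<Rightarrow> (real ^ 'n \<Rightarrow> real) \<Rightarrow> bool" where
  "source_potential C_R G R \<longleftrightarrow>
     (\<forall>u. R differentiable at u) \<and> (\<forall>u. G u = - grad R u) \<and>
     (\<forall>u. R u \<ge> R 0) \<and> R 0 = 0 \<and> grad R 0 = 0 \<and>
     (\<forall>u. norm (grad R u) = norm (G u) \<and> norm (G u) \<le> C_R * (1 + R u))"

section \<open>Solutions on the strip\<close>

text \<open>Functions on the strip are curried, with the space variable first. The time derivative is
  one-sided at \<open>t = 0\<close> and \<open>t = T\<close>.\<close>

definition D_x :: "(real \<Rightarrow> real \<Rightarrow> 'b::real_normed_vector) \<Rightarrow> real \<Rightarrow> real \<Rightarrow> 'b" where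
  "D_x u x t = vector_derivative (\<lambda>y. u y t) (at x)"

definition D_t :: "real \<Rightarrow> (real \<Rightarrow> real \<Rightarrow> 'b::real_normed_vector) \<Rightarrow> real \<Rightarrow> real \<Rightarrow> 'b" where
  "D_t T u x t = vector_derivative (\<lambda>s. u x s) (at t within {0..T})"

definition smooth_solution ::
    "real \<Rightarrow> real ^ 'n ^ 'n \<Rightarrow> (real ^ 'n \<Rightarrow> real ^ 'n) \<Rightarrow> (real ^ 'n \<Rightarrow> real ^ 'n) \<Rightarrow> real \<Rightarrow>
       (real \<Rightarrow> real \<Rightarrow> real ^ 'n) \<Rightarrow> bool" where
  "smooth_solution T A F G \<epsilon> u \<longleftrightarrow>
     smooth_on (\<lambda>(x, t). u x t) (UNIV \<times> {0..T}) \<and>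
     (\<forall>x. \<forall>t\<in>{0..T}.
        D_t T u x t + D_x (\<lambda>y s. F (u y s)) x t =
        G (u x t) + \<epsilon> *\<^sub>R (A *v D_x (D_x u) x t - D_t T (D_t T u) x t))"

definition energy_density ::
    "real \<Rightarrow> real \<Rightarrow> (real \<Rightarrow> real \<Rightarrow> real ^ 'n) \<Rightarrow> real \<Rightarrow> real \<Rightarrow> real" where
  "energy_density T \<epsilon> u x t =
     (norm (u x t))\<^sup>2 + \<epsilon>\<^sup>2 * (norm (D_x u x t))\<^sup>2 + \<epsilon>\<^sup>2 * (norm (D_t T u x t))\<^sup>2"

definition energy :: "real \<Rightarrow> real \<Rightarrow> (real \<Rightarrow> real \<Rightarrow> real ^ 'n) \<Rightarrow> real \<Rightarrow> real" where
  "energy T \<epsilon> u t = (LINT x|lborel. energy_density T \<epsilon> u x t)"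

text \<open>The integral of \<open>e\<close> over the real line is finite and may be differentiated in \<open>t\<close> under the
  integral sign.\<close>

definition differentiable_under_integral :: "real \<Rightarrow> (real \<Rightarrow> real \<Rightarrow> real) \<Rightarrow> bool" where
  "differentiable_under_integral T e \<longleftrightarrow>
     (\<forall>t\<in>{0..T}.
        integrable lborel (\<lambda>x. e x t) \<and> integrable lborel (\<lambda>x. D_t T e x t) \<and>
        ((\<lambda>s. LINT x|lborel. e x s) has_real_derivative (LINT x|lborel. D_t T e x t))
          (at t within {0..T}))"

text \<open>Fast decay at infinity: all derivatives tend to \<open>0\<close> as \<open>\<bar>x\<bar> \<rightarrow> \<infinity>\<close>, uniformly in \<open>t\<close>, and the
  integrals over the real line in the energy estimate are finite and may be differentiated in \<open>t\<close>.
  The last integrand is only asked to be integrable, since \<open>G\<close> is merely continuous.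
  That boundary terms from integration in \<open>x\<close> vanish follows from the first condition: these terms
  are differences of values at \<open>x \<rightarrow> \<plusminus>\<infinity>\<close> of continuous functions of \<open>u\<close> and its derivatives.\<close>

definition decays_fast ::
    "real \<Rightarrow> (real ^ 'n \<Rightarrow> real) \<Rightarrow> (real ^ 'n \<Rightarrow> real ^ 'n) \<Rightarrow> (real ^ 'n \<Rightarrow> real) \<Rightarrow> real \<Rightarrow>
       (real \<Rightarrow> real \<Rightarrow> real ^ 'n) \<Rightarrow> bool" where
  "decays_fast T \<eta> G R \<epsilon> u \<longleftrightarrow>
     (\<forall>i j. uniform_limit {0..T} ((D_x ^^ i) ((D_t T ^^ j) u)) (\<lambda>_. 0) at_infinity) \<and>
     differentiable_under_integral T (energy_density T \<epsilon> u) \<and>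
     differentiable_under_integral T (\<lambda>x t. R (u x t)) \<and>
     (\<forall>t\<in>{0..T}. integrable lborel (\<lambda>x. \<bar>grad \<eta> (u x t) \<bullet> G (u x t)\<bar>))"

end

theory Submission
  imports Defs
begin

text \<open>Write \<open>v = u\<^sub>x\<close>, \<open>w = u\<^sub>t\<close> and \<open>g = D \<eta>(u)\<close>. Pairing the equation with \<open>g + \<alpha> \<epsilon> w\<close> gives a
  balance law \<open>P\<^sub>t + Q\<^sub>x = g \<bullet> G(u) - \<epsilon> S\<close> with
  \<open>P = \<eta>(u) + \<epsilon> g \<bullet> w + \<alpha> \<epsilon>\<^sup>2 (|w|\<^sup>2 + v \<bullet> A v) / 2 + \<alpha> \<epsilon> R(u)\<close> and
  \<open>Q = q(u) - \<epsilon> g \<bullet> A v - \<alpha> \<epsilon>\<^sup>2 w \<bullet> A v\<close>. The remainder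
  \<open>S = D\<^sup>2\<eta> v \<bullet> A v - w \<bullet> D\<^sup>2\<eta> w + \<alpha> |w|\<^sup>2 + \<alpha> w \<bullet> D F v\<close> is nonnegative by the subcharacteristic
  condition and \<open>D\<^sup>2\<eta> \<le> \<alpha>/2\<close>, and \<open>g \<bullet> G(u) \<le> 0\<close> by weak dissipation at \<open>0\<close>. Since \<open>\<eta> \<ge> 0\<close>, the same
  bound on \<open>D\<^sup>2\<eta>\<close> gives \<open>|g|\<^sup>2 \<le> \<alpha> \<eta>\<close>, so the cross term \<open>\<epsilon> g \<bullet> w\<close> is absorbed and \<open>P - \<alpha> \<epsilon> R(u)\<close> is
  equivalent to the energy density. The balance law is integrated over \<open>[-n, n] \<times> [0, t]\<close>; the
  boundary terms vanish as \<open>n \<rightarrow> \<infinity>\<close>, and monotone convergence also yields that the dissipation is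
  integrable in time.\<close>

section \<open>Smooth functions on the strip\<close>

text \<open>Derivatives within \<open>S\<close> depend only on the values on \<open>S\<close>, so
  \<open>f\<close> and \<open>g\<close> have the same Frechet derivatives at points of
  \<open>S\<close> and the induction passes to these. This lets \<open>D_x\<close> and
  \<open>D_t\<close>, which are known to agree with directional derivatives only on the strip,
  inherit smoothness.\<close>

lemma C_k_on_cong:
  assumes "C_k_on k f S" "\<And>x. x \<in> S \<Longrightarrow> f x = g x"
  shows "C_k_on k g S"
  using assms
proof (induction k arbitrary: f g)
  case 0
  then show ?case using continuous_on_cong[of S S f g] by simp
next
  case (Suc k)
  have d: "(f has_derivative D) (at x within S) \<longleftrightarrow> (g has_derivative D) (at x within S)"
    if "x \<in> S" for x D
    using has_derivative_transform[of x S f g D] has_derivative_transform[of x S g f D]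
      Suc.prems(2) that by auto
  have fd: "frechet_derivative f (at x within S) = frechet_derivative g (at x within S)"
    if "x \<in> S" for x
    unfolding frechet_derivative_def using d[OF that] by simp
  have "f differentiable_on S" using Suc.prems(1) by simp
  then have "g differentiable_on S"
    unfolding differentiable_on_def differentiable_def by (simp add: d)
  moreover have "C_k_on k (\<lambda>x. frechet_derivative g (at x within S) v) S" for v
    by (rule Suc.IH[of "\<lambda>x. frechet_derivative f (at x within S) v"])
       (use Suc.prems(1) fd in auto)
  ultimately show ?case by simp
qed

lemma smooth_on_cong:
  "smooth_on f S \<Longrightarrow> (\<And>x. x \<in> S \<Longrightarrow> f x = g x) \<Longrightarrow> smooth_on g S"
  unfolding smooth_on_def using C_k_on_cong by blast

lemma smooth_on_continuous_on: "smooth_on f S \<Longrightarrow> continuous_on S f"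
  unfolding smooth_on_def by (metis C_k_on.simps(1))

lemma smooth_on_has_derivative:
  assumes "smooth_on f S" "x \<in> S"
  shows "(f has_derivative frechet_derivative f (at x within S)) (at x within S)"
proof -
  have "C_k_on (Suc 0) f S" using assms(1) unfolding smooth_on_def by blast
  then show ?thesis
    using assms(2) by (simp add: differentiable_on_def frechet_derivative_works)
qed

lemma smooth_on_frechet_derivative:
  assumes "smooth_on f S"
  shows "smooth_on (\<lambda>x. frechet_derivative f (at x within S) v) S"
  unfolding smooth_on_def
proof
  fix k
  have "C_k_on (Suc k) f S" using assms unfolding smooth_on_def by blast
  then show "C_k_on k (\<lambda>x. frechet_derivative f (at x within S) v) S" by simp
qed

section \<open>Partial derivatives along the coordinate lines of the strip\<close>

text \<open>Chain rule along the horizontal line through \<open>(x, t)\<close>. This line lies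
  entirely in the strip, so the space derivative is two-sided even at \<open>t = 0\<close> and
  \<open>t = T\<close>.\<close>

lemma strip_has_derivative_x:
  fixes u :: "real \<Rightarrow> real \<Rightarrow> 'b::real_normed_vector"
  assumes "smooth_on (\<lambda>(x, t). u x t) (UNIV \<times> {0..T})" "t \<in> {0..T}"
  shows "((\<lambda>y. u y t) has_vector_derivative
      frechet_derivative (\<lambda>(x, t). u x t) (at (x, t) within UNIV \<times> {0..T}) (1, 0)) (at x)"
proof -
  let ?S = "(UNIV :: real set) \<times> {0..T}" and ?f = "\<lambda>(x, t). u x t"
  have "(?f has_derivative frechet_derivative ?f (at (x, t) within ?S)) (at (x, t) within ?S)"
    using assms by (intro smooth_on_has_derivative) auto
  then have 1: "(?f has_derivative frechet_derivative ?f (at (x, t) within ?S))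
      (at (x, t) within (\<lambda>y. (y, t)) ` UNIV)"
    by (rule has_derivative_subset) (use assms in auto)
  have "((\<lambda>y. (y, t)) has_vector_derivative (1, 0)) (at x)"
    by (auto simp: has_vector_derivative_def intro!: derivative_eq_intros)
  from vector_derivative_diff_chain_within[OF this 1] show ?thesis
    by (simp add: o_def)
qed

lemma strip_has_derivative_t:
  fixes u :: "real \<Rightarrow> real \<Rightarrow> 'b::real_normed_vector"
  assumes "smooth_on (\<lambda>(x, t). u x t) (UNIV \<times> {0..T})" "t \<in> {0..T}"
  shows "((\<lambda>s. u x s) has_vector_derivative
      frechet_derivative (\<lambda>(x, t). u x t) (at (x, t) within UNIV \<times> {0..T}) (0, 1))
      (at t within {0..T})"
proof -
  let ?S = "(UNIV :: real set) \<times> {0..T}" and ?f = "\<lambda>(x, t). u x t"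
  have "(?f has_derivative frechet_derivative ?f (at (x, t) within ?S)) (at (x, t) within ?S)"
    using assms by (intro smooth_on_has_derivative) auto
  then have 1: "(?f has_derivative frechet_derivative ?f (at (x, t) within ?S))
      (at (x, t) within (\<lambda>s. (x, s)) ` {0..T})"
    by (rule has_derivative_subset) (use assms in auto)
  have "((\<lambda>s. (x, s)) has_vector_derivative (0, 1)) (at t within {0..T})"
    by (auto simp: has_vector_derivative_def intro!: derivative_eq_intros)
  from vector_derivative_diff_chain_within[OF this 1] show ?thesis
    by (simp add: o_def)
qed

lemma D_x_has_vector_derivative:
  fixes u :: "real \<Rightarrow> real \<Rightarrow> 'b::real_normed_vector"
  assumes "smooth_on (\<lambda>(x, t). u x t) (UNIV \<times> {0..T})" "t \<in> {0..T}"
  shows "((\<lambda>y. u y t) has_vector_derivative D_x u x t) (at x)"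
  using strip_has_derivative_x[OF assms] vector_derivative_at unfolding D_x_def by metis

text \<open>For \<open>T > 0\<close> a derivative within the closed interval is unique, so
  \<open>D_t\<close> is the one found by the chain rule.\<close>

lemma D_t_has_vector_derivative:
  fixes u :: "real \<Rightarrow> real \<Rightarrow> 'b::euclidean_space"
  assumes "smooth_on (\<lambda>(x, t). u x t) (UNIV \<times> {0..T})" "t \<in> {0..T}" "T > 0"
  shows "((\<lambda>s. u x s) has_vector_derivative D_t T u x t) (at t within {0..T})"
  using strip_has_derivative_t[OF assms(1,2)]
    vector_derivative_within_closed_interval[OF assms(3,2)] unfolding D_t_def by metis

lemma smooth_on_D_x:
  fixes u :: "real \<Rightarrow> real \<Rightarrow> 'b::real_normed_vector"
  assumes "smooth_on (\<lambda>(x, t). u x t) (UNIV \<times> {0..T})"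
  shows "smooth_on (\<lambda>(x, t). D_x u x t) (UNIV \<times> {0..T})"
  using smooth_on_frechet_derivative[OF assms]
proof (rule smooth_on_cong)
  fix p :: "real \<times> real" assume "p \<in> UNIV \<times> {0..T}"
  then show "frechet_derivative (\<lambda>(x, t). u x t) (at p within UNIV \<times> {0..T}) (1, 0) =
      (case p of (x, t) \<Rightarrow> D_x u x t)"
    unfolding D_x_def
    using vector_derivative_at[OF strip_has_derivative_x[OF assms]] by (cases p) auto
qed

lemma smooth_on_D_t:
  fixes u :: "real \<Rightarrow> real \<Rightarrow> 'b::euclidean_space"
  assumes "smooth_on (\<lambda>(x, t). u x t) (UNIV \<times> {0..T})" "T > 0"
  shows "smooth_on (\<lambda>(x, t). D_t T u x t) (UNIV \<times> {0..T})"
  using smooth_on_frechet_derivative[OF assms(1)]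
proof (rule smooth_on_cong)
  fix p :: "real \<times> real" assume "p \<in> UNIV \<times> {0..T}"
  then show "frechet_derivative (\<lambda>(x, t). u x t) (at p within UNIV \<times> {0..T}) (0, 1) =
      (case p of (x, t) \<Rightarrow> D_t T u x t)"
    unfolding D_t_def
    using vector_derivative_within_closed_interval[OF assms(2) _ strip_has_derivative_t[OF assms(1)]]
    by (cases p) auto
qed

section \<open>Exchange of the space and time derivatives\<close>

lemma continuous_on_slices:
  assumes "continuous_on (UNIV \<times> S) (\<lambda>(x, t). f x t)"
  shows "s \<in> S \<Longrightarrow> continuous_on X (\<lambda>x. f x s)" "continuous_on S (f x)"
proof -
  have "continuous_on X (\<lambda>x. (x, s))" by (intro continuous_intros)
  from continuous_on_compose2[OF assms this] show "continuous_on X (\<lambda>x. f x s)" if "s \<in> S"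
    using that by auto
  have "continuous_on S (\<lambda>s. (x, s))" 
    by (rule continuous_on_Pair[OF continuous_on_const continuous_on_id])
  from continuous_on_compose2[OF assms this] show "continuous_on S (f x)"
    by auto
qed

text \<open>Writing \<open>f\<close> as the time integral of \<open>f\<^sub>t\<close> and differentiating under the integral in \<open>x\<close>
  exchanges the derivatives also at the end points of the interval, where they are one-sided.\<close>

lemma mixed_partial_derivatives:
  fixes f :: "real \<Rightarrow> real \<Rightarrow> 'b::euclidean_space"
  assumes ft: "\<And>x t. t \<in> {0..T} \<Longrightarrow>
      ((\<lambda>s. f x s) has_vector_derivative ft x t) (at t within {0..T})"
    and fx: "\<And>x t. t \<in> {0..T} \<Longrightarrow> ((\<lambda>y. f y t) has_vector_derivative fx x t) (at x)"
    and ftx: "\<And>x t. t \<in> {0..T} \<Longrightarrow> ((\<lambda>y. ft y t) has_vector_derivative ftx x t) (at x)"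
    and cft: "\<And>x. continuous_on {0..T} (ft x)"
    and cftx: "continuous_on (UNIV \<times> {0..T}) (\<lambda>(x, t). ftx x t)"
    and t: "t \<in> {0..T}"
  shows "((\<lambda>s. fx x s) has_vector_derivative ftx x t) (at t within {0..T})"
proof -
  have eq: "fx x s = fx x 0 + integral {0..s} (ftx x)" if s: "s \<in> {0..T}" for s
  proof -
    have ftc: "f y s = f y 0 + integral {0..s} (ft y)" for y
    proof -
      have "(ft y has_integral f y s - f y 0) {0..s}"
      proof (rule fundamental_theorem_of_calculus)
        fix r assume "r \<in> {0..s}"
        then show "(f y has_vector_derivative ft y r) (at r within {0..s})"
          by (intro has_vector_derivative_within_subset[OF ft]) (use s in auto)
      qed (use s in auto)
      then show ?thesis by (simp add: integral_unique)
    qed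
    have "((\<lambda>y. integral (cbox 0 s) (ft y)) has_vector_derivative integral (cbox 0 s) (ftx x))
        (at x within UNIV)"
    proof (rule leibniz_rule_vector_derivative)
      show "continuous_on (UNIV \<times> cbox 0 s) (\<lambda>(x, t). ftx x t)"
        by (rule continuous_on_subset[OF cftx]) (use s in auto)
      show "ft y integrable_on cbox 0 s" for y
        by (intro integrable_continuous continuous_on_subset[OF cft]) (use s in auto)
    qed (use s ftx in auto)
    then have "((\<lambda>y. f y 0 + integral (cbox 0 s) (ft y)) has_vector_derivative
        fx x 0 + integral (cbox 0 s) (ftx x)) (at x)"
      using s by (intro has_vector_derivative_add fx) auto
    then have "((\<lambda>y. f y s) has_vector_derivative fx x 0 + integral {0..s} (ftx x)) (at x)"
      by (simp add: ftc[symmetric])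
    \<comment> \<open>Two derivatives of the same function of \<open>y\<close> have been found, and
      they must coincide.\<close>
    with fx[OF s] show ?thesis using vector_derivative_unique_at by blast
  qed
  have "continuous_on {0..T} (ftx x)"
    by (rule continuous_on_slices(2)[OF cftx])
  then have "((\<lambda>s. integral {0..s} (ftx x)) has_vector_derivative ftx x t) (at t within {0..T})"
    using t by (rule integral_has_vector_derivative)
  then have "((\<lambda>s. fx x 0 + integral {0..s} (ftx x)) has_vector_derivative ftx x t)
      (at t within {0..T})"
    using has_vector_derivative_add[OF has_vector_derivative_const] by fastforce
  then show ?thesis
    by - (rule has_vector_derivative_transform[OF t], rule eq)
qed

text \<open>Makes the time derivative of \<open>u_x\<close> equal to the space derivative of
  \<open>u_t\<close>. The balance law relies on this: the term from the time derivative of v.Av in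
  the density cancels the one from the space derivative of w.Av in the flux.\<close>

lemma D_t_D_x:
  fixes u :: "real \<Rightarrow> real \<Rightarrow> 'b::euclidean_space"
  assumes u: "smooth_on (\<lambda>(x, t). u x t) (UNIV \<times> {0..T})" and "T > 0" "t \<in> {0..T}"
  shows "((\<lambda>s. D_x u x s) has_vector_derivative D_x (D_t T u) x t) (at t within {0..T})"
proof (rule mixed_partial_derivatives[of T u "D_t T u"])
  show "continuous_on {0..T} (D_t T u x)" for x
    by (rule continuous_on_slices(2)[OF smooth_on_continuous_on[OF smooth_on_D_t[OF u \<open>T > 0\<close>]]])
  show "continuous_on (UNIV \<times> {0..T}) (\<lambda>(x, t). D_x (D_t T u) x t)"
    by (intro smooth_on_continuous_on smooth_on_D_x smooth_on_D_t assms)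
qed (use assms in \<open>auto intro: D_t_has_vector_derivative D_x_has_vector_derivative smooth_on_D_t\<close>)

section \<open>Gradients and Hessians\<close>

lemma frechet_derivative_eq_grad:
  assumes "f differentiable (at u)"
  shows "frechet_derivative f (at u) v = grad f u \<bullet> v"
proof -
  interpret linear "frechet_derivative f (at u)"
    using assms linear_frechet_derivative by blast
  have "frechet_derivative f (at u) v = frechet_derivative f (at u) (\<Sum>i\<in>UNIV. v $ i *\<^sub>R axis i 1)"
    using basis_expansion[of v] by (simp add: scalar_mult_eq_scaleR)
  also have "\<dots> = grad f u \<bullet> v"
    by (simp add: sum scale grad_def inner_vec_def mult.commute)
  finally show ?thesis .
qed

lemma has_derivative_grad:
  "f differentiable (at u) \<Longrightarrow> (f has_derivative (\<lambda>v. grad f u \<bullet> v)) (at u)"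
  using frechet_derivative_eq_grad[of f u] frechet_derivative_works[of f "at u"]
  by presburger

lemma smooth_on_UNIV_differentiable: "smooth_on f UNIV \<Longrightarrow> f differentiable (at u)"
  using smooth_on_has_derivative[of f UNIV u] differentiable_def by blast

lemma smooth_on_grad_component:
  fixes \<eta> :: "real ^ 'n \<Rightarrow> real"
  assumes "smooth_on \<eta> UNIV"
  shows "smooth_on (\<lambda>u. grad \<eta> u $ i) UNIV"
  using smooth_on_frechet_derivative[OF assms, of "axis i 1"] by (simp add: grad_def)

lemma has_derivative_hess:
  fixes \<eta> :: "real ^ 'n \<Rightarrow> real"
  assumes "smooth_on \<eta> UNIV"
  shows "(grad \<eta> has_derivative (\<lambda>v. hess \<eta> u *v v)) (at u)"
proof -
  have "(\<lambda>u. grad \<eta> u $ i) differentiable (at u)" for i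
    by (rule smooth_on_UNIV_differentiable[OF smooth_on_grad_component[OF assms]])
  then have "grad \<eta> differentiable (at u)"
    by (subst differentiable_componentwise_within)
       (auto simp: Basis_vec_def inner_axis)
  then show ?thesis by (simp add: jacobian_works hess_def)
qed

lemma continuous_on_grad:
  fixes \<eta> :: "real ^ 'n \<Rightarrow> real"
  assumes "smooth_on \<eta> UNIV"
  shows "continuous_on UNIV (grad \<eta>)"
  using has_derivative_continuous[OF has_derivative_hess[OF assms]]
  by (simp add: continuous_at_imp_continuous_on)

lemma has_derivative_vec_nth:
  "(f has_derivative f') F \<Longrightarrow> ((\<lambda>x. f x $ i) has_derivative (\<lambda>h. f' h $ i)) F"
  by (rule bounded_linear.has_derivative[OF bounded_linear_vec_nth])

lemma continuous_on_jacobian: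
  fixes F :: "real ^ 'n \<Rightarrow> real ^ 'm"
  assumes "smooth_on F UNIV"
  shows "continuous_on UNIV (\<lambda>u. jacobian F (at u))"
proof -
  have "continuous_on UNIV (\<lambda>u. frechet_derivative F (at u) (axis j 1) $ i)" for i j
    by (intro continuous_intros smooth_on_continuous_on smooth_on_frechet_derivative assms)
  then show ?thesis
    unfolding jacobian_def matrix_def by (intro continuous_on_vec_lambda)
qed

text \<open>Each entry of the Hessian is a directional derivative of a gradient component, which is
  again smooth.\<close>

lemma continuous_on_hess:
  fixes \<eta> :: "real ^ 'n \<Rightarrow> real"
  assumes "smooth_on \<eta> UNIV"
  shows "continuous_on UNIV (hess \<eta>)"
proof -
  have "hess \<eta> u $ i $ j = frechet_derivative (\<lambda>u. grad \<eta> u $ i) (at u) (axis j 1)" for u i j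
  proof -
    have "((\<lambda>u. grad \<eta> u $ i) has_derivative (\<lambda>v. (hess \<eta> u *v v) $ i)) (at u)"
      by (intro has_derivative_vec_nth has_derivative_hess assms)
    from frechet_derivative_at[OF this, symmetric] show ?thesis
      by (simp add: matrix_vector_mul_component inner_axis)
  qed
  moreover have "continuous_on UNIV (\<lambda>u. frechet_derivative (\<lambda>u. grad \<eta> u $ i) (at u) (axis j 1))"
    for i j
    by (intro smooth_on_continuous_on smooth_on_frechet_derivative smooth_on_grad_component assms)
  ultimately have "continuous_on UNIV (\<lambda>u. hess \<eta> u $ i $ j)" for i j
    by simp
  then have "continuous_on UNIV (\<lambda>u. \<chi> i j. hess \<eta> u $ i $ j)"
    by (intro continuous_on_vec_lambda)
  then show ?thesis by simp
qed

lemma continuous_on_matrix_vector_mult: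
  fixes M :: "'a::topological_space \<Rightarrow> real ^ 'n ^ 'm"
  assumes "continuous_on S M" "continuous_on S v"
  shows "continuous_on S (\<lambda>x. M x *v v x)"
  unfolding matrix_vector_mult_def
  by (intro continuous_on_vec_lambda continuous_on_sum continuous_on_mult
      continuous_on_component assms)

section \<open>Second-order information: symmetry, Taylor expansion, quadratic bounds\<close>

text \<open>Restrict \<open>\<eta>\<close> to the plane \<open>p + x v + t w\<close> and exchange
  the two derivatives by \<open>mixed_partial_derivatives\<close> on the strip of height 1; at the
  origin of the plane the mixed derivatives are the two bilinear expressions.\<close>

lemma hess_symmetric:
  fixes \<eta> :: "real ^ 'n \<Rightarrow> real"
  assumes "smooth_on \<eta> UNIV"
  shows "v \<bullet> (hess \<eta> p *v w) = w \<bullet> (hess \<eta> p *v v)"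
proof -
  let ?l = "\<lambda>x t. p + x *\<^sub>R v + t *\<^sub>R w"
  have lx: "((\<lambda>y. ?l y t) has_vector_derivative v) (at x)" for x t
    by (auto simp: has_vector_derivative_def intro!: derivative_eq_intros)
  have lt: "((\<lambda>s. ?l x s) has_vector_derivative w) (at t within {0..1})" for x t
    by (auto simp: has_vector_derivative_def intro!: derivative_eq_intros)
  have D: "(\<eta> has_derivative (\<lambda>v. grad \<eta> u \<bullet> v)) (at u)" for u
    by (intro has_derivative_grad smooth_on_UNIV_differentiable assms)
  have H: "((\<lambda>u. grad \<eta> u \<bullet> z) has_derivative (\<lambda>v. (hess \<eta> u *v v) \<bullet> z)) (at u)" for u z
    by (intro has_derivative_inner_left has_derivative_hess assms)
  note chain = vector_derivative_diff_chain_within[unfolded o_def]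
  have vw: "((\<lambda>s. grad \<eta> (?l 0 s) \<bullet> v) has_vector_derivative (hess \<eta> (?l 0 0) *v v) \<bullet> w)
      (at 0 within {0..1})"
  proof (rule mixed_partial_derivatives[where f = "\<lambda>x t. \<eta> (?l x t)"
        and fx = "\<lambda>x t. grad \<eta> (?l x t) \<bullet> v" and ft = "\<lambda>x t. grad \<eta> (?l x t) \<bullet> w"
        and ftx = "\<lambda>x t. (hess \<eta> (?l x t) *v v) \<bullet> w"])
    show "continuous_on {0..1} (\<lambda>t. grad \<eta> (?l x t) \<bullet> w)" for x
      by (intro continuous_intros continuous_on_compose2[OF continuous_on_grad[OF assms]]) auto
    show "continuous_on (UNIV \<times> {0..1}) (\<lambda>(x, t). (hess \<eta> (?l x t) *v v) \<bullet> w)"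
      unfolding case_prod_beta
      by (intro continuous_intros continuous_on_matrix_vector_mult
          continuous_on_compose2[OF continuous_on_hess[OF assms]]) auto
  qed (rule chain[OF lx has_derivative_at_withinI[OF D]] chain[OF lt has_derivative_at_withinI[OF D]]
      chain[OF lx has_derivative_at_withinI[OF H]] | simp)+
  \<comment> \<open>Direct differentiation of the function already treated in \<open>vw\<close>; the
    one-sided derivative at 0 is unique, so both values agree.\<close>
  have wv: "((\<lambda>s. grad \<eta> (?l 0 s) \<bullet> v) has_vector_derivative (hess \<eta> (?l 0 0) *v w) \<bullet> v)
      (at 0 within {0..1})"
    by (rule chain[OF lt has_derivative_at_withinI[OF H]])
  have "(hess \<eta> (?l 0 0) *v v) \<bullet> w = (hess \<eta> (?l 0 0) *v w) \<bullet> v"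
    using vector_derivative_within_closed_interval[OF zero_less_one _ vw]
      vector_derivative_within_closed_interval[OF zero_less_one _ wv] by simp
  then show ?thesis by (simp add: inner_commute)
qed

text \<open>Maclaurin's formula of order two for the function \<open>\<eta> (u + t h)\<close> of
  \<open>t\<close> on the unit interval; \<open>p\<close> is the intermediate point of the Lagrange
  remainder.\<close>

lemma second_order_taylor:
  fixes \<eta> :: "real ^ 'n \<Rightarrow> real"
  assumes "smooth_on \<eta> UNIV"
  obtains p where "\<eta> (u + h) = \<eta> u + grad \<eta> u \<bullet> h + (h \<bullet> (hess \<eta> p *v h)) / 2"
proof -
  define d where "d m t = (if m = 0 then \<eta> (u + t *\<^sub>R h) else if m = 1 then grad \<eta> (u + t *\<^sub>R h) \<bullet> h
    else h \<bullet> (hess \<eta> (u + t *\<^sub>R h) *v h))" for m :: nat and t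
  have l: "((\<lambda>t. u + t *\<^sub>R h) has_vector_derivative h) (at t)" for t
    by (auto simp: has_vector_derivative_def intro!: derivative_eq_intros)
  note chain = vector_derivative_diff_chain_within[unfolded o_def, OF l has_derivative_at_withinI]
  have D: "(\<eta> has_derivative (\<lambda>v. grad \<eta> u \<bullet> v)) (at u)" for u
    by (intro has_derivative_grad smooth_on_UNIV_differentiable assms)
  have H: "((\<lambda>u. grad \<eta> u \<bullet> h) has_derivative (\<lambda>v. (hess \<eta> u *v v) \<bullet> h)) (at u)" for u
    by (intro has_derivative_inner_left has_derivative_hess assms)
  have d: "d 0 = (\<lambda>t. \<eta> (u + t *\<^sub>R h))" "d (Suc 0) = (\<lambda>t. grad \<eta> (u + t *\<^sub>R h) \<bullet> h)"
      "d (Suc (Suc 0)) = (\<lambda>t. (hess \<eta> (u + t *\<^sub>R h) *v h) \<bullet> h)"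
    by (simp_all add: d_def fun_eq_iff inner_commute)
  have "\<forall>m t. m < 2 \<and> 0 \<le> t \<and> t \<le> 1 \<longrightarrow> DERIV (d m) t :> d (Suc m) t"
    using chain[OF D] chain[OF H]
    by (auto simp: d less_2_cases_iff has_real_derivative_iff_has_vector_derivative)
  from Maclaurin[of 1 2 d "d 0", OF _ _ _ this] obtain t where
    "d 0 1 = (\<Sum>m<2. d m 0 / fact m) + d 2 t / 2" by (auto simp: fact_numeral)
  then have "\<eta> (u + h) = \<eta> u + grad \<eta> u \<bullet> h + (h \<bullet> (hess \<eta> (u + t *\<^sub>R h) *v h)) / 2"
    by (simp add: d_def numeral_2_eq_2)
  then show ?thesis by (rule that)
qed

lemma qform_mat: "v \<bullet> (mat c *v v) = c * (norm (v :: real ^ 'n))\<^sup>2"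
proof -
  have "mat c = c *\<^sub>R (mat 1 :: real ^ 'n ^ 'n)"
    by (simp add: vec_eq_iff mat_def)
  then show ?thesis
    by (simp add: scaleR_matrix_vector_assoc[symmetric] power2_norm_eq_inner)
qed

text \<open>Expand \<open>\<eta>\<close> at \<open>u - D \<eta>(u) / M\<close>, where it is still nonnegative.\<close>

lemma square_grad_le:
  fixes \<eta> :: "real ^ 'n \<Rightarrow> real"
  assumes "smooth_on \<eta> UNIV" "\<And>u. hess \<eta> u \<sqsubseteq>\<^sub>q mat M" "M > 0" "\<And>u. \<eta> u \<ge> 0"
  shows "(norm (grad \<eta> u))\<^sup>2 \<le> 2 * M * \<eta> u"
proof -
  define h where "h = - (1 / M) *\<^sub>R grad \<eta> u"
  define c where "c = (norm (grad \<eta> u))\<^sup>2 / M"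
  obtain p where p: "\<eta> (u + h) = \<eta> u + grad \<eta> u \<bullet> h + (h \<bullet> (hess \<eta> p *v h)) / 2"
    using second_order_taylor[OF assms(1)] .
  have "h \<bullet> (hess \<eta> p *v h) \<le> M * (norm h)\<^sup>2"
    using assms(2)[of p] by (simp add: qform_le_def qform_mat)
  moreover have "grad \<eta> u \<bullet> h = - c"
    by (simp add: h_def c_def power2_norm_eq_inner)
  moreover have "M * (norm h)\<^sup>2 = c"
    using assms(3) by (simp add: h_def c_def power_mult_distrib power2_eq_square)
  \<comment> \<open>The linear term is \<open>-c\<close> and the quadratic one at most
    \<open>c / 2\<close>, so 0 \<le> \<open>\<eta> (u + h)\<close> \<le>
    \<open>\<eta> u - c / 2\<close>.\<close>
  ultimately have "c \<le> 2 * \<eta> u"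
    using p assms(4)[of "u + h"] by linarith
  then show ?thesis using assms(3) by (simp add: c_def field_simps)
qed

text \<open>The quadratic form attains its extrema on the compact unit sphere, where it is positive,
  and scales quadratically. The bounds depend on \<open>A\<close> alone, as the final constant
  must.\<close>

lemma sym_pos_def_bounds:
  fixes A :: "real ^ 'n ^ 'n"
  assumes "sym_pos_def A"
  obtains l L where "l > 0" "L > 0" "\<And>v. l * (norm v)\<^sup>2 \<le> v \<bullet> (A *v v)"
    "\<And>v. v \<bullet> (A *v v) \<le> L * (norm v)\<^sup>2"
proof -
  let ?S = "sphere (0 :: real ^ 'n) 1"
  have c: "continuous_on ?S (\<lambda>v. v \<bullet> (A *v v))"
    by (intro continuous_intros continuous_on_matrix_vector_mult)
  have ne: "?S \<noteq> {}" using sphere_eq_empty[of "0 :: real ^ 'n" 1] by simp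
  obtain a where a: "a \<in> ?S" "\<And>v. v \<in> ?S \<Longrightarrow> a \<bullet> (A *v a) \<le> v \<bullet> (A *v v)"
    using continuous_attains_inf[OF compact_sphere ne c] by blast
  obtain b where b: "b \<in> ?S" "\<And>v. v \<in> ?S \<Longrightarrow> v \<bullet> (A *v v) \<le> b \<bullet> (A *v b)"
    using continuous_attains_sup[OF compact_sphere ne c] by blast
  have pos: "0 < v \<bullet> (A *v v)" if "v \<in> ?S" for v
    using assms that unfolding sym_pos_def_def by (metis dist_0_norm mem_sphere norm_zero zero_neq_one)
  have hom: "v \<bullet> (A *v v) = (sgn v \<bullet> (A *v sgn v)) * (norm v)\<^sup>2" for v :: "real ^ 'n"
  proof -
    have "v = norm v *\<^sub>R sgn v" by (cases "v = 0") (simp_all add: sgn_div_norm)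
    then have "v \<bullet> (A *v v) = (norm v *\<^sub>R sgn v) \<bullet> (A *v (norm v *\<^sub>R sgn v))" by metis
    also have "\<dots> = (sgn v \<bullet> (A *v sgn v)) * (norm v)\<^sup>2"
      by (simp add: matrix_vector_mult_scaleR power2_eq_square)
    finally show ?thesis .
  qed
  show ?thesis
  proof (rule that[OF pos[OF a(1)] pos[OF b(1)]])
    fix v :: "real ^ 'n"
    show "a \<bullet> (A *v a) * (norm v)\<^sup>2 \<le> v \<bullet> (A *v v)" "v \<bullet> (A *v v) \<le> b \<bullet> (A *v b) * (norm v)\<^sup>2"
      using a(2)[of "sgn v"] b(2)[of "sgn v"] hom[of v]
      \<comment> \<open>\<open>sgn 0 = 0\<close> is not on the sphere, so the zero vector is treated
        separately.\<close>
      by (cases "v = 0"; simp add: norm_sgn mult_right_mono)+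
  qed
qed

section \<open>Balance laws\<close>

text \<open>Dominated convergence with majorant |h|: at each point the indicator is eventually
  1.\<close>

lemma integrable_tendsto_symmetric_interval:
  fixes h :: "real \<Rightarrow> real"
  assumes "integrable lborel h"
  shows "(\<lambda>n. LINT x:{- real n..real n}|lborel. h x) \<longlonglongrightarrow> (LINT x|lborel. h x)"
  unfolding set_lebesgue_integral_def
proof (rule integral_dominated_convergence[where w = "\<lambda>x. \<bar>h x\<bar>"])
  show "AE x in lborel. (\<lambda>n. indicat_real {- real n..real n} x *\<^sub>R h x) \<longlonglongrightarrow> h x"
  proof (rule AE_I2)
    fix x :: real
    obtain N where N: "\<bar>x\<bar> \<le> real N" using real_arch_simple by blast
    have "\<forall>\<^sub>F n in sequentially. indicat_real {- real n..real n} x *\<^sub>R h x = h x"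
      using eventually_ge_at_top[of N]
    proof eventually_elim
      case (elim n)
      then have "real N \<le> real n" by simp
      with N have "x \<in> {- real n..real n}" by (simp; linarith)
      then show ?case by simp
    qed
    then show "(\<lambda>n. indicat_real {- real n..real n} x *\<^sub>R h x) \<longlonglongrightarrow> h x"
      by (rule tendsto_eventually)
  qed
qed (use assms in \<open>auto simp: indicator_def\<close>)

lemma continuous_on_integral_slice:
  fixes f :: "real \<Rightarrow> real \<Rightarrow> real"
  assumes "continuous_on (UNIV \<times> S) (\<lambda>(x, t). f x t)"
  shows "continuous_on S (\<lambda>s. integral {a..b} (\<lambda>x. f x s))"
proof -
  \<comment> \<open>The coordinates are swapped because the theorem on parameter integrals expects
    the parameter first.\<close>
  have "continuous_on (S \<times> cbox a b) (\<lambda>p. (\<lambda>(x, t). f x t) (snd p, fst p))"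
    by (rule continuous_on_compose2[OF assms]) (intro continuous_intros, auto)
  then have "continuous_on (S \<times> cbox a b) (\<lambda>(s, x). f x s)"
    by (simp add: case_prod_beta)
  from integral_continuous_on_param[OF this] show ?thesis by simp
qed

text \<open>Integrate the differential inequality first in space, then in time, and interchange the
  integrals of the continuous \<open>Pt\<close>. The continuity of the boundary flux is recorded
  because its time integral is later estimated by a bound on the integrand.\<close>

lemma balance_law_on_rectangle:
  fixes P Q Pt Qx k :: "real \<Rightarrow> real \<Rightarrow> real"
  assumes \<tau>: "0 \<le> \<tau>" and ab: "a \<le> b"
    and P: "\<And>x s. s \<in> {0..\<tau>} \<Longrightarrow> ((\<lambda>s. P x s) has_real_derivative Pt x s) (at s within {0..\<tau>})"
    and Q: "\<And>x s. s \<in> {0..\<tau>} \<Longrightarrow> ((\<lambda>y. Q y s) has_real_derivative Qx x s) (at x)"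
    and cPt: "continuous_on (UNIV \<times> {0..\<tau>}) (\<lambda>(x, s). Pt x s)"
    and cQx: "continuous_on (UNIV \<times> {0..\<tau>}) (\<lambda>(x, s). Qx x s)"
    and ck: "continuous_on (UNIV \<times> {0..\<tau>}) (\<lambda>(x, s). k x s)"
    and le: "\<And>x s. s \<in> {0..\<tau>} \<Longrightarrow> Pt x s + Qx x s \<le> - k x s"
  shows "integral {a..b} (\<lambda>x. P x \<tau> - P x 0) + integral {0..\<tau>} (\<lambda>s. integral {a..b} (\<lambda>x. k x s))
      \<le> integral {0..\<tau>} (\<lambda>s. Q a s - Q b s)"
    and "continuous_on {0..\<tau>} (\<lambda>s. Q a s - Q b s)"
proof -
  have ftcP: "P x \<tau> - P x 0 = integral {0..\<tau>} (Pt x)" for x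
    using fundamental_theorem_of_calculus[of 0 \<tau> "P x" "Pt x"] P \<tau>
    by (simp add: has_real_derivative_iff_has_vector_derivative integral_unique)
  have ftcQ: "Q a s - Q b s = - integral {a..b} (\<lambda>x. Qx x s)" if "s \<in> {0..\<tau>}" for s
  proof -
    have "((\<lambda>x. Qx x s) has_integral (Q b s - Q a s)) {a..b}"
      using Q[OF that] ab
      by (intro fundamental_theorem_of_calculus)
         (auto simp: has_real_derivative_iff_has_vector_derivative intro: has_vector_derivative_at_within)
    then show ?thesis by (simp add: integral_unique)
  qed
  \<comment> \<open>No continuity of \<open>Q\<close> in time is assumed; the flux difference
    inherits it from the integral of \<open>Qx\<close>.\<close>
  have "continuous_on {0..\<tau>} (\<lambda>s. - integral {a..b} (\<lambda>x. Qx x s))"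
    by (intro continuous_intros continuous_on_integral_slice cQx)
  then show cQ: "continuous_on {0..\<tau>} (\<lambda>s. Q a s - Q b s)"
    by (rule continuous_on_eq) (simp add: ftcQ)
  have "integral (cbox a b) (\<lambda>x. integral (cbox 0 \<tau>) (Pt x)) =
      integral (cbox 0 \<tau>) (\<lambda>s. integral (cbox a b) (\<lambda>x. Pt x s))"
    by (rule integral_swap_continuous, rule continuous_on_subset[OF cPt])
       (auto simp: cbox_Pair_eq)
  then have "integral {a..b} (\<lambda>x. P x \<tau> - P x 0) =
      integral {0..\<tau>} (\<lambda>s. integral {a..b} (\<lambda>x. Pt x s))"
    by (simp add: ftcP)
  also have "\<dots> \<le> integral {0..\<tau>} (\<lambda>s. (Q a s - Q b s) - integral {a..b} (\<lambda>x. k x s))"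
  proof (rule integral_le)
    fix s assume s: "s \<in> {0..\<tau>}"
    note i = integrable_continuous_interval continuous_intros
      continuous_on_slices(1)[OF cPt s] continuous_on_slices(1)[OF cQx s] continuous_on_slices(1)[OF ck s]
    have "integral {a..b} (\<lambda>x. Pt x s) \<le> integral {a..b} (\<lambda>x. - Qx x s - k x s)"
    proof (rule integral_le)
      show "Pt x s \<le> - Qx x s - k x s" for x using le[OF s, of x] by linarith
    qed (intro i)+
    also have "\<dots> = integral {a..b} (\<lambda>x. - Qx x s) - integral {a..b} (\<lambda>x. k x s)"
      by (rule Henstock_Kurzweil_Integration.integral_diff) (intro i)+
    also have "\<dots> = (Q a s - Q b s) - integral {a..b} (\<lambda>x. k x s)"
      using ftcQ[OF s] by simp
    finally show "integral {a..b} (\<lambda>x. Pt x s) \<le> \<dots>" .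
  qed (intro integrable_continuous_interval continuous_intros cQ continuous_on_integral_slice cPt ck)+
  also have "\<dots> = integral {0..\<tau>} (\<lambda>s. Q a s - Q b s)
      - integral {0..\<tau>} (\<lambda>s. integral {a..b} (\<lambda>x. k x s))"
    by (rule Henstock_Kurzweil_Integration.integral_diff)
       (intro integrable_continuous_interval cQ continuous_on_integral_slice ck)+
  finally show "integral {a..b} (\<lambda>x. P x \<tau> - P x 0)
      + integral {0..\<tau>} (\<lambda>s. integral {a..b} (\<lambda>x. k x s)) \<le> integral {0..\<tau>} (\<lambda>s. Q a s - Q b s)"
    by linarith
qed

text \<open>Exhaust the line by the intervals [-n, n]. The boundary flux disappears by uniform
  decay, and the nonnegativity of \<open>k\<close> makes the dissipation integrals increase with
  \<open>n\<close>, so the inequality itself supplies their finite limit.\<close>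

lemma balance_law_on_line:
  fixes P Q Pt Qx k :: "real \<Rightarrow> real \<Rightarrow> real"
  assumes \<tau>: "0 \<le> \<tau>"
    and P: "\<And>x s. s \<in> {0..\<tau>} \<Longrightarrow> ((\<lambda>s. P x s) has_real_derivative Pt x s) (at s within {0..\<tau>})"
    and Q: "\<And>x s. s \<in> {0..\<tau>} \<Longrightarrow> ((\<lambda>y. Q y s) has_real_derivative Qx x s) (at x)"
    and cPt: "continuous_on (UNIV \<times> {0..\<tau>}) (\<lambda>(x, s). Pt x s)"
    and cQx: "continuous_on (UNIV \<times> {0..\<tau>}) (\<lambda>(x, s). Qx x s)"
    and ck: "continuous_on (UNIV \<times> {0..\<tau>}) (\<lambda>(x, s). k x s)"
    and le: "\<And>x s. s \<in> {0..\<tau>} \<Longrightarrow> Pt x s + Qx x s \<le> - k x s"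
    and k0: "\<And>x s. 0 \<le> k x s"
    and lim: "uniform_limit {0..\<tau>} Q (\<lambda>_. 0) at_infinity"
    and iP: "integrable lborel (\<lambda>x. P x 0)" "integrable lborel (\<lambda>x. P x \<tau>)"
    and ik: "\<And>s. s \<in> {0..\<tau>} \<Longrightarrow> integrable lborel (\<lambda>x. k x s)"
  shows "set_integrable lborel {0..\<tau>} (\<lambda>s. LINT x|lborel. k x s) \<and>
    (LINT x|lborel. P x \<tau>) + (LINT s:{0..\<tau>}|lborel. LINT x|lborel. k x s) \<le> (LINT x|lborel. P x 0)"
proof -
  define I where "I n = {- real n..real n}" for n
  define \<kappa> where "\<kappa> n s = integral (I n) (\<lambda>x. k x s)" for n s
  define d where "d n = integral (I n) (\<lambda>x. P x \<tau> - P x 0)" for n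
  define r where "r n = integral {0..\<tau>} (\<lambda>s. Q (- real n) s - Q (real n) s)" for n
  \<comment> \<open>Written as a Lebesgue integral with an indicator, ready for monotone
    convergence; \<open>K_eq\<close> identifies it with the integral on the rectangle.\<close>
  define K where "K n = (LINT s|lborel. indicat_real {0..\<tau>} s *\<^sub>R \<kappa> n s)" for n
  have \<kappa>': "\<kappa> n = (\<lambda>s. integral (I n) (\<lambda>x. k x s))" for n
    by (simp add: \<kappa>_def fun_eq_iff)
  have c\<kappa>: "continuous_on {0..\<tau>} (\<kappa> n)" for n
    unfolding \<kappa>' I_def by (rule continuous_on_integral_slice[OF ck])
  have si\<kappa>: "set_integrable lborel {0..\<tau>} (\<kappa> n)" for n
    by (rule borel_integrable_atLeastAtMost'[OF c\<kappa>])
  have K_eq: "K n = integral {0..\<tau>} (\<kappa> n)" for n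
    using set_borel_integral_eq_integral(2)[OF si\<kappa>[of n]] by (simp add: K_def set_lebesgue_integral_def)
  have \<kappa>_eq: "\<kappa> n s = (LINT x:I n|lborel. k x s)" if "s \<in> {0..\<tau>}" for n s
    unfolding \<kappa>_def I_def
    by (rule set_borel_integral_eq_integral(2)[symmetric],
        rule borel_integrable_atLeastAtMost'[OF continuous_on_slices(1)[OF ck that]])
  have \<kappa>_lim: "(\<lambda>n. \<kappa> n s) \<longlonglongrightarrow> (LINT x|lborel. k x s)" if "s \<in> {0..\<tau>}" for s
    using integrable_tendsto_symmetric_interval[OF ik[OF that]] \<kappa>_eq[OF that]
    by (simp add: I_def)
  have \<kappa>_mono: "\<kappa> m s \<le> \<kappa> n s" if "s \<in> {0..\<tau>}" "m \<le> n" for m n s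
    unfolding \<kappa>_def I_def using that k0
    by (intro integral_subset_le integrable_continuous_interval continuous_on_slices(1)[OF ck]) auto
  have d_lim: "d \<longlonglongrightarrow> (LINT x|lborel. P x \<tau>) - (LINT x|lborel. P x 0)"
  proof -
    have i: "integrable lborel (\<lambda>x. P x \<tau> - P x 0)" using iP by simp
    have "d = (\<lambda>n. LINT x:{- real n..real n}|lborel. P x \<tau> - P x 0)"
      unfolding d_def I_def
      by (rule ext, rule set_borel_integral_eq_integral(2)[symmetric])
         (unfold set_integrable_def, intro integrable_mult_indicator i, simp)
    with integrable_tendsto_symmetric_interval[OF i] iP show ?thesis by simp
  qed
  have rect: "d n + K n \<le> r n" "continuous_on {0..\<tau>} (\<lambda>s. Q (- real n) s - Q (real n) s)" for n
    using balance_law_on_rectangle[of \<tau> "- real n" "real n" P Pt Q Qx k, OF \<tau> _ P Q cPt cQx ck le]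
    by (simp_all add: d_def r_def K_eq \<kappa>' I_def)
  have r_lim: "r \<longlonglongrightarrow> 0"
  proof (rule LIMSEQ_I)
    fix e :: real assume e: "e > 0"
    \<comment> \<open>The flux difference is at most \<open>2 * e'\<close>, so its time integral is
      at most e \<tau> / (\<tau> + 1), which is below \<open>e\<close> also when \<tau> = 0.\<close>
    define e' where "e' = e / (2 * (\<tau> + 1))"
    have e': "e' > 0" "2 * e' * \<tau> < e"
      using e \<tau> by (auto simp: e'_def field_simps)
    have ev: "\<forall>\<^sub>F x in at_infinity. \<forall>s\<in>{0..\<tau>}. \<bar>Q x s\<bar> < e'"
      using uniform_limitD[OF lim e'(1)] by simp
    have "filterlim (\<lambda>n. real n) at_infinity sequentially"
      by (rule filterlim_mono[OF filterlim_real_sequentially at_top_le_at_infinity order_refl])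
    moreover have "filterlim (\<lambda>n. - real n) at_infinity sequentially"
      by (rule filterlim_mono[OF _ at_bot_le_at_infinity order_refl])
         (simp add: filterlim_uminus_at_bot filterlim_real_sequentially)
    ultimately have "\<forall>\<^sub>F n in sequentially. (\<forall>s\<in>{0..\<tau>}. \<bar>Q (real n) s\<bar> < e')"
      "\<forall>\<^sub>F n in sequentially. (\<forall>s\<in>{0..\<tau>}. \<bar>Q (- real n) s\<bar> < e')"
      using eventually_compose_filterlim[OF ev] by blast+
    then have "\<forall>\<^sub>F n in sequentially. norm (r n - 0) < e"
    proof eventually_elim
      case (elim n)
      have "norm (r n) \<le> 2 * e' * (\<tau> - 0)"
        unfolding r_def
      proof (rule integral_bound)
        fix s assume "s \<in> {0..\<tau>}"
        then show "norm (Q (- real n) s - Q (real n) s) \<le> 2 * e'"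
          using elim[THEN bspec, of s] by (simp; linarith)
      qed (use \<tau> rect(2) in auto)
      with e'(2) show ?case by simp
    qed
    then show "\<exists>N. \<forall>n\<ge>N. norm (r n - 0) < e" by (simp add: eventually_sequentially)
  qed
  have K_mono: "mono K"
  proof (rule monoI)
    fix m n :: nat assume "m \<le> n"
    then show "K m \<le> K n"
      unfolding K_eq by (intro integral_le integrable_continuous_interval c\<kappa> \<kappa>_mono)
  qed
  have K_le: "K n \<le> r n - d n" for n using rect(1)[of n] by linarith
  have rd: "(\<lambda>n. r n - d n) \<longlonglongrightarrow> (LINT x|lborel. P x 0) - (LINT x|lborel. P x \<tau>)"
    using tendsto_diff[OF r_lim d_lim] by simp
  then have "Bseq (\<lambda>n. r n - d n)" by (intro convergent_imp_Bseq) (auto simp: convergent_def)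
  \<comment> \<open>The increasing sequence \<open>K\<close> lies below a convergent, hence bounded,
    sequence; so it converges, and its limit obeys the limiting inequality.\<close>
  then obtain B where B: "\<forall>n. norm (r n - d n) \<le> B" unfolding Bseq_def by blast
  have "K n \<le> B" for n
  proof -
    have "\<bar>r n - d n\<bar> \<le> B" using spec[OF B, of n] unfolding real_norm_def .
    with K_le[of n] show ?thesis by linarith
  qed
  with K_mono obtain L where L: "K \<longlonglongrightarrow> L"
    using incseq_convergent[of K B] by blast
  have Lle: "L \<le> (LINT x|lborel. P x 0) - (LINT x|lborel. P x \<tau>)"
    by (rule LIMSEQ_le[OF L rd]) (use K_le in auto)
  let ?f = "\<lambda>n s. indicat_real {0..\<tau>} s *\<^sub>R \<kappa> n s"
  let ?g = "\<lambda>s. indicat_real {0..\<tau>} s *\<^sub>R (LINT x|lborel. k x s)"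
  have fi: "integrable lborel (?f n)" for n
    using si\<kappa>[of n] by (simp add: set_integrable_def)
  have fg: "(\<lambda>n. ?f n s) \<longlonglongrightarrow> ?g s" for s
    using \<kappa>_lim[of s] by (cases "s \<in> {0..\<tau>}") auto
  have gm: "?g \<in> borel_measurable lborel"
    by (rule borel_measurable_LIMSEQ_real[OF fg]) (use fi in \<open>auto simp: borel_measurable_integrable\<close>)
  have fm: "AE s in lborel. mono (\<lambda>n. ?f n s)"
    by (intro AE_I2 monoI) (auto simp: indicator_def \<kappa>_mono)
  \<comment> \<open>Because the integrals have the finite limit \<open>L\<close>, monotone
    convergence yields both the integrability of \<open>?g\<close> and the value \<open>L\<close> of
    its integral.\<close>
  note mc = integrable_monotone_convergence[OF fi fm AE_I2[OF fg] L[unfolded K_def] gm]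
    integral_monotone_convergence[OF fi fm AE_I2[OF fg] L[unfolded K_def] gm]
  show ?thesis
    using mc Lle by (simp add: set_integrable_def set_lebesgue_integral_def)
qed

section \<open>The energy estimate\<close>

text \<open>The pointwise algebra of the balance law, with z = u_tt, m = u_tx, p = u_xx, b = G(u),
  \<open>H\<close> the Hessian of the entropy and \<open>J\<close> the Jacobian of the flux. The
  first bracket is the time derivative of the density, the second the space derivative of the flux.
  Pairing \<open>eq\<close> with \<open>g\<close> and with \<alpha> \<epsilon> w removes all second
  derivatives of u.\<close>

lemma dissipation_inequality:
  fixes g w v z m p b :: "real ^ 'n" and A H J :: "real ^ 'n ^ 'n"
  assumes A: "transpose A = A"
    and eq: "w + J *v v = b + \<epsilon> *\<^sub>R (A *v p - z)"
    and H: "w \<bullet> (H *v w) \<le> \<alpha> / 2 * (norm w)\<^sup>2"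
    and J: "\<alpha> * (norm (J *v v))\<^sup>2 \<le> (H *v v) \<bullet> (A *v v)"
    and pos: "\<alpha> > 0" "\<epsilon> > 0"
  shows "(g \<bullet> w + \<epsilon> * (g \<bullet> z + (H *v w) \<bullet> w)
        + \<alpha> * \<epsilon>\<^sup>2 / 2 * ((w \<bullet> z + z \<bullet> w) + (v \<bullet> (A *v m) + m \<bullet> (A *v v))) + \<alpha> * \<epsilon> * - (b \<bullet> w))
      + (g \<bullet> (J *v v) - \<epsilon> * (g \<bullet> (A *v p) + (H *v v) \<bullet> (A *v v))
        - \<alpha> * \<epsilon>\<^sup>2 * (w \<bullet> (A *v p) + m \<bullet> (A *v v))) \<le> g \<bullet> b"
proof -
  have m: "v \<bullet> (A *v m) = m \<bullet> (A *v v)"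
    using dot_lmul_matrix[of v A m] A vector_transpose_matrix[of v A] by (simp add: inner_commute)
  have g: "\<epsilon> * (g \<bullet> (A *v p)) - \<epsilon> * (g \<bullet> z) = g \<bullet> w + g \<bullet> (J *v v) - g \<bullet> b"
    using arg_cong[OF eq, of "\<lambda>y. g \<bullet> y"] by (simp add: inner_add_right inner_diff_right algebra_simps)
  have w: "\<epsilon> * (w \<bullet> (A *v p)) - \<epsilon> * (w \<bullet> z) = (norm w)\<^sup>2 + w \<bullet> (J *v v) - b \<bullet> w"
    using arg_cong[OF eq, of "\<lambda>y. w \<bullet> y"]
    by (simp add: inner_add_right inner_diff_right power2_norm_eq_inner inner_commute algebra_simps)
  \<comment> \<open>Completing the square bounds -\<alpha> w.Jv by \<alpha>/2 (|w|^2 + |Jv|^2). With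
    \<open>H\<close> the two halves of \<alpha> |w|^2 are used up exactly, and \<open>J\<close>
    leaves -\<alpha>/2 |Jv|^2.\<close>
  have "0 \<le> (norm (w + J *v v))\<^sup>2" by simp
  then have "0 \<le> \<alpha> / 2 * ((norm w)\<^sup>2 + 2 * (w \<bullet> (J *v v)) + (norm (J *v v))\<^sup>2)"
    using pos by (simp add: power2_norm_eq_inner inner_add_left inner_add_right inner_commute)
  then have "w \<bullet> (H *v w) - (H *v v) \<bullet> (A *v v) - \<alpha> * ((norm w)\<^sup>2 + w \<bullet> (J *v v))
      \<le> - \<alpha> / 2 * (norm (J *v v))\<^sup>2"
    using H J by (simp add: algebra_simps)
  also have "\<dots> \<le> 0" using pos by simp
  finally have neg: "\<epsilon> * (w \<bullet> (H *v w) - (H *v v) \<bullet> (A *v v) - \<alpha> * ((norm w)\<^sup>2 + w \<bullet> (J *v v))) \<le> 0"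
    using pos by (simp add: mult_le_0_iff)
  have w': "\<alpha> * \<epsilon>\<^sup>2 * (w \<bullet> (A *v p)) - \<alpha> * \<epsilon>\<^sup>2 * (w \<bullet> z)
      = \<alpha> * \<epsilon> * (norm w)\<^sup>2 + \<alpha> * \<epsilon> * (w \<bullet> (J *v v)) - \<alpha> * \<epsilon> * (b \<bullet> w)"
    using arg_cong[OF w, of "\<lambda>y. \<alpha> * \<epsilon> * y"] by (simp add: algebra_simps power2_eq_square)
  show ?thesis
    using neg g w' m by (simp add: algebra_simps inner_commute)
qed

text \<open>The cross term is split by \<open>0 \<le> (4 |g| - 3 \<alpha> |\<epsilon> w|)\<^sup>2\<close>: this leaves positive multiples of both
  \<open>e\<close> and \<open>\<epsilon>\<^sup>2 |w|\<^sup>2\<close>.\<close>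

lemma energy_density_equivalence:
  fixes u v w g :: "real ^ 'n" and e a \<epsilon> \<alpha> \<beta> l L :: real
  assumes pos: "\<alpha> > 0" "L > 0"
    and g: "(norm g)\<^sup>2 \<le> \<alpha> * e" and e: "\<beta> / 2 * (norm u)\<^sup>2 \<le> e" "e \<le> \<alpha> / 4 * (norm u)\<^sup>2"
    and a: "l * (norm v)\<^sup>2 \<le> a" "a \<le> L * (norm v)\<^sup>2"
  defines "E \<equiv> (norm u)\<^sup>2 + \<epsilon>\<^sup>2 * (norm v)\<^sup>2 + \<epsilon>\<^sup>2 * (norm w)\<^sup>2"
    and "p \<equiv> e + \<epsilon> * (g \<bullet> w) + \<alpha> * \<epsilon>\<^sup>2 / 2 * (w \<bullet> w + a)"
  shows "min (\<beta> / 6) (min (\<alpha> / 8) (\<alpha> * l / 2)) * E \<le> p" "p \<le> \<alpha> * (1 + L) * E"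
proof -
  define W where "W = \<epsilon>\<^sup>2 * (norm w)\<^sup>2"
  define V where "V = \<epsilon>\<^sup>2 * (norm v)\<^sup>2"
  have nn: "W \<ge> 0" "V \<ge> 0" "(norm u)\<^sup>2 \<ge> 0" by (auto simp: W_def V_def)
  have c: "\<bar>\<epsilon> * (g \<bullet> w)\<bar> \<le> 2 / 3 * e + 3 / 8 * \<alpha> * W"
  proof -
    have "24 * \<alpha> * \<bar>\<epsilon> * (g \<bullet> w)\<bar> \<le> 24 * \<alpha> * (norm g * (\<bar>\<epsilon>\<bar> * norm w))"
      using Cauchy_Schwarz_ineq2[of g w] pos
      by (simp add: abs_mult mult.left_commute mult_left_mono)
    also have "\<dots> \<le> 16 * (norm g)\<^sup>2 + 9 * \<alpha>\<^sup>2 * W"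
      using zero_le_power2[of "4 * norm g - 3 * \<alpha> * (\<bar>\<epsilon>\<bar> * norm w)"]
      by (simp add: W_def power2_eq_square algebra_simps abs_mult_self_eq)
    also have "\<dots> \<le> 24 * \<alpha> * (2 / 3 * e + 3 / 8 * \<alpha> * W)"
      using g by (simp add: algebra_simps power2_eq_square)
    finally show ?thesis using pos by simp
  qed
  have p: "p = e + \<epsilon> * (g \<bullet> w) + \<alpha> / 2 * W + \<alpha> / 2 * (\<epsilon>\<^sup>2 * a)"
    by (simp add: p_def W_def power2_norm_eq_inner algebra_simps)
  have a': "l * V \<le> \<epsilon>\<^sup>2 * a" "\<epsilon>\<^sup>2 * a \<le> L * V"
    using mult_left_mono[OF a(1), of "\<epsilon>\<^sup>2"] mult_left_mono[OF a(2), of "\<epsilon>\<^sup>2"]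
    by (simp_all add: V_def mult_ac)
  have a'': "\<alpha> / 2 * (l * V) \<le> \<alpha> / 2 * (\<epsilon>\<^sup>2 * a)" "\<alpha> / 2 * (\<epsilon>\<^sup>2 * a) \<le> \<alpha> / 2 * (L * V)"
    using mult_left_mono[OF a'(1), of "\<alpha> / 2"] mult_left_mono[OF a'(2), of "\<alpha> / 2"] pos by simp_all
  let ?c = "min (\<beta> / 6) (min (\<alpha> / 8) (\<alpha> * l / 2))"
  have E: "E = (norm u)\<^sup>2 + V + W" by (simp add: E_def V_def W_def)
  \<comment> \<open>After absorbing the cross term, e/3 and \<alpha> W/8 remain; the lower bound on
    \<open>e\<close> turns e/3 into the coefficient \<beta>/6.\<close>
  have "?c * E = ?c * (norm u)\<^sup>2 + ?c * V + ?c * W" by (simp add: E algebra_simps)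
  also have "\<dots> \<le> \<beta> / 6 * (norm u)\<^sup>2 + \<alpha> * l / 2 * V + \<alpha> / 8 * W"
    by (intro add_mono mult_right_mono nn) auto
  also have "\<dots> \<le> p"
    using c a''(1) e(1) unfolding p by (simp add: abs_le_iff)
  finally show "?c * E \<le> p" .
  \<comment> \<open>Here 5/3 = 1 + 2/3 and 7/8 = 1/2 + 3/8; the upper bound on \<open>e\<close> then
    gives 5/3 * \<alpha>/4 = 5/12 * \<alpha>.\<close>
  have "p \<le> 5 / 3 * e + 7 / 8 * \<alpha> * W + \<alpha> / 2 * (L * V)"
    using c a''(2) unfolding p by (simp add: abs_le_iff)
  also have "\<dots> \<le> 5 / 12 * \<alpha> * (norm u)\<^sup>2 + 7 / 8 * \<alpha> * W + \<alpha> / 2 * (L * V)"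
    using e(2) by simp
  also have "\<dots> \<le> \<alpha> * (1 + L) * (norm u)\<^sup>2 + \<alpha> * (1 + L) * W + \<alpha> * (1 + L) * V"
  proof (intro add_mono)
    have "0 \<le> \<alpha> * L" using pos by simp
    then show "5 / 12 * \<alpha> * (norm u)\<^sup>2 \<le> \<alpha> * (1 + L) * (norm u)\<^sup>2"
      "7 / 8 * \<alpha> * W \<le> \<alpha> * (1 + L) * W"
      using pos by (intro mult_right_mono nn; simp add: algebra_simps)+
    have "\<alpha> / 2 * L * V \<le> \<alpha> * (1 + L) * V"
      using pos \<open>0 \<le> \<alpha> * L\<close> by (intro mult_right_mono nn) (simp add: algebra_simps)
    then show "\<alpha> / 2 * (L * V) \<le> \<alpha> * (1 + L) * V" by simp
  qed
  also have "\<dots> = \<alpha> * (1 + L) * E" by (simp add: E algebra_simps)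
  finally show "p \<le> \<alpha> * (1 + L) * E" .
qed

section \<open>Uniform decay of continuous functions of the solution\<close>

lemma uniform_limit_Pair_0:
  fixes f :: "'i \<Rightarrow> 's \<Rightarrow> 'a::real_normed_vector" and g :: "'i \<Rightarrow> 's \<Rightarrow> 'b::real_normed_vector"
  assumes "uniform_limit S f (\<lambda>_. 0) F" "uniform_limit S g (\<lambda>_. 0) F"
  shows "uniform_limit S (\<lambda>x s. (f x s, g x s)) (\<lambda>_. 0) F"
proof (rule uniform_limitI)
  fix e :: real assume "e > 0"
  then have "\<forall>\<^sub>F x in F. \<forall>s\<in>S. norm (f x s) < e / 2" "\<forall>\<^sub>F x in F. \<forall>s\<in>S. norm (g x s) < e / 2"
    using uniform_limitD[OF assms(1), of "e / 2"] uniform_limitD[OF assms(2), of "e / 2"] by simp_all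
  then show "\<forall>\<^sub>F x in F. \<forall>s\<in>S. dist (f x s, g x s) 0 < e"
  proof eventually_elim
    case (elim x)
    show ?case
    proof
      fix s assume "s \<in> S"
      then have "norm (f x s) + norm (g x s) < e" using elim by fastforce
      then show "dist (f x s, g x s) 0 < e"
        using norm_Pair_le[of "f x s" "g x s"] by simp
    qed
  qed
qed

text \<open>Continuity at the single point 0 suffices, since the arguments eventually lie in any
  given ball around 0, uniformly over \<open>S\<close>. It carries the decay of u, u_x, u_t over to
  the flux.\<close>

lemma uniform_limit_isCont_0:
  fixes \<Phi> :: "'a::real_normed_vector \<Rightarrow> 'b::metric_space"
  assumes "isCont \<Phi> 0" "uniform_limit S f (\<lambda>_. 0) F"
  shows "uniform_limit S (\<lambda>x s. \<Phi> (f x s)) (\<lambda>_. \<Phi> 0) F"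
proof (rule uniform_limitI)
  fix e :: real assume "e > 0"
  then obtain d where d: "d > 0" "\<And>y. dist y 0 < d \<Longrightarrow> dist (\<Phi> y) (\<Phi> 0) < e"
    using assms(1) unfolding continuous_at_eps_delta by blast
  show "\<forall>\<^sub>F x in F. \<forall>s\<in>S. dist (\<Phi> (f x s)) (\<Phi> 0) < e"
    using uniform_limitD[OF assms(2) d(1)] by eventually_elim (use d(2) in blast)
qed

lemma has_vector_derivative_inner:
  fixes f g :: "real \<Rightarrow> 'a::real_inner"
  assumes "(f has_vector_derivative f') (at x within S)" "(g has_vector_derivative g') (at x within S)"
  shows "((\<lambda>x. f x \<bullet> g x) has_real_derivative (f x \<bullet> g' + f' \<bullet> g x)) (at x within S)"
  unfolding has_real_derivative_iff_has_vector_derivative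
  by (rule bounded_bilinear.has_vector_derivative[OF bounded_bilinear_inner assms])

lemma has_vector_derivative_matrix_vector_mult:
  fixes A :: "real ^ 'n ^ 'm"
  shows "(f has_vector_derivative f') F \<Longrightarrow> ((\<lambda>x. A *v f x) has_vector_derivative A *v f') F"
  by (rule bounded_linear.has_vector_derivative[OF matrix_vector_mul_bounded_linear])

lemma entropy_quadratic_bounds:
  fixes \<eta> :: "real ^ 'n \<Rightarrow> real"
  assumes "smooth_on \<eta> UNIV" "\<And>u. mat a \<sqsubseteq>\<^sub>q hess \<eta> u" "\<And>u. hess \<eta> u \<sqsubseteq>\<^sub>q mat b"
    "\<eta> 0 = 0" "grad \<eta> 0 = 0"
  shows "a / 2 * (norm u)\<^sup>2 \<le> \<eta> u" "\<eta> u \<le> b / 2 * (norm u)\<^sup>2"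
proof -
  obtain p where "\<eta> (0 + u) = \<eta> 0 + grad \<eta> 0 \<bullet> u + (u \<bullet> (hess \<eta> p *v u)) / 2"
    using second_order_taylor[OF assms(1)] .
  then have p: "\<eta> u = (u \<bullet> (hess \<eta> p *v u)) / 2" by (simp add: assms)
  show "a / 2 * (norm u)\<^sup>2 \<le> \<eta> u" "\<eta> u \<le> b / 2 * (norm u)\<^sup>2"
    using assms(2,3)[of p] unfolding qform_le_def qform_mat p by (simp_all add: qform_mat)
qed

text \<open>The integrated balance law for one fixed \<epsilon>, with the density replaced by its
  lower bound at time \<open>t\<close> and its upper bound at time 0. The source potential keeps the
  coefficient \<alpha> \<epsilon> on both sides.\<close>

lemma energy_estimate:
  fixes A :: "real ^ 'n ^ 'n" and u :: "real \<Rightarrow> real \<Rightarrow> real ^ 'n"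
  assumes symA: "transpose A = A"
    and A: "\<And>v. l * (norm v)\<^sup>2 \<le> v \<bullet> (A *v v)" "\<And>v. v \<bullet> (A *v v) \<le> L * (norm v)\<^sup>2"
    and pos: "L > 0" "\<alpha> > 0" "\<epsilon> > 0" "T > 0"
    and F: "smooth_on F UNIV" and G: "continuous_on UNIV G" "G 0 = 0"
    and sol: "smooth_solution T A F G \<epsilon> u" and dec: "decays_fast T \<eta> G R \<epsilon> u"
    and ent: "entropy_pair \<alpha> \<beta> F \<eta> q"
    and sub: "\<nu> > 0" "subcharacteristic A \<alpha> \<nu> F \<eta>"
    and dis: "weakly_dissipative G \<eta>" and src: "source_potential C_R G R"
    and t: "t \<in> {0..T}"
  defines "c \<equiv> min (\<beta> / 6) (min (\<alpha> / 8) (\<alpha> * l / 2))"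
    and "k \<equiv> (\<lambda>x s. \<bar>grad \<eta> (u x s) \<bullet> G (u x s)\<bar>)"
  shows "set_integrable lborel {0..t} (\<lambda>s. LINT x|lborel. k x s) \<and>
    c * energy T \<epsilon> u t + \<alpha> * \<epsilon> * (LINT x|lborel. R (u x t))
      + (LINT s:{0..t}|lborel. LINT x|lborel. k x s)
    \<le> \<alpha> * (1 + L) * energy T \<epsilon> u 0 + \<alpha> * \<epsilon> * (LINT x|lborel. R (u x 0))"
proof -
  have \<eta>: "smooth_on \<eta> UNIV" and q: "smooth_on q UNIV"
    and grad_q: "\<And>u. grad \<eta> u v* jacobian F (at u) = grad q u"
    and Hl: "\<And>u. mat \<beta> \<sqsubseteq>\<^sub>q hess \<eta> u" and Hu: "\<And>u. hess \<eta> u \<sqsubseteq>\<^sub>q mat (\<alpha> / 2)"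
    and \<eta>0: "\<eta> 0 = 0" "grad \<eta> 0 = 0" and \<eta>_nonneg: "\<And>u. 0 \<le> \<eta> u"
    using ent unfolding entropy_pair_def by auto
  have R: "\<And>u. R differentiable at u" "\<And>u. grad R u = - G u" "\<And>u. 0 \<le> R u"
    using src unfolding source_potential_def by auto
  define V where "V = D_x u"
  define W where "W = D_t T u"
  define Z where "Z = D_t T W"
  define m where "m = D_x W"
  define p where "p = D_x V"
  define J where "J = (\<lambda>u. jacobian F (at u))"
  let ?S = "(UNIV :: real set) \<times> {0..T}"
  have su: "smooth_on (\<lambda>(x, t). u x t) ?S" using sol unfolding smooth_solution_def by blast
  have sV: "smooth_on (\<lambda>(x, t). V x t) ?S" unfolding V_def by (rule smooth_on_D_x[OF su])
  have sW: "smooth_on (\<lambda>(x, t). W x t) ?S" unfolding W_def by (rule smooth_on_D_t[OF su pos(4)])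
  have sZ: "smooth_on (\<lambda>(x, t). Z x t) ?S" unfolding Z_def by (rule smooth_on_D_t[OF sW pos(4)])
  have sm: "smooth_on (\<lambda>(x, t). m x t) ?S" unfolding m_def by (rule smooth_on_D_x[OF sW])
  have sp: "smooth_on (\<lambda>(x, t). p x t) ?S" unfolding p_def by (rule smooth_on_D_x[OF sV])

  have ux: "((\<lambda>y. u y s) has_vector_derivative V x s) (at x)" if "s \<in> {0..T}" for x s
    unfolding V_def by (rule D_x_has_vector_derivative[OF su that])
  have Vx: "((\<lambda>y. V y s) has_vector_derivative p x s) (at x)" if "s \<in> {0..T}" for x s
    unfolding p_def by (rule D_x_has_vector_derivative[OF sV that])
  have Wx: "((\<lambda>y. W y s) has_vector_derivative m x s) (at x)" if "s \<in> {0..T}" for x s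
    unfolding m_def by (rule D_x_has_vector_derivative[OF sW that])
  have ut: "((\<lambda>s. u x s) has_vector_derivative W x s) (at s within {0..T})" if "s \<in> {0..T}" for x s
    unfolding W_def by (rule D_t_has_vector_derivative[OF su that pos(4)])
  have Wt: "((\<lambda>s. W x s) has_vector_derivative Z x s) (at s within {0..T})" if "s \<in> {0..T}" for x s
    unfolding Z_def by (rule D_t_has_vector_derivative[OF sW that pos(4)])
  have Vt: "((\<lambda>s. V x s) has_vector_derivative m x s) (at s within {0..T})" if "s \<in> {0..T}" for x s
    unfolding V_def m_def W_def by (rule D_t_D_x[OF su pos(4) that])

  \<comment> \<open>These derivatives are taken within an arbitrary set, to serve both the one-sided
    time derivatives and the space derivatives.\<close>
  have D\<eta>: "(\<eta> has_derivative (\<lambda>v. grad \<eta> u \<bullet> v)) (at u within S)" for u S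
    by (rule has_derivative_at_withinI[OF has_derivative_grad[OF smooth_on_UNIV_differentiable[OF \<eta>]]])
  have Dq: "(q has_derivative (\<lambda>v. grad \<eta> u \<bullet> (J u *v v))) (at u within S)" for u S
  proof -
    have "(q has_derivative (\<lambda>v. grad q u \<bullet> v)) (at u within S)"
      by (rule has_derivative_at_withinI[OF has_derivative_grad[OF smooth_on_UNIV_differentiable[OF q]]])
    then show ?thesis
      by (simp add: grad_q[symmetric] J_def dot_lmul_matrix)
  qed
  have DR: "(R has_derivative (\<lambda>v. - (G u \<bullet> v))) (at u within S)" for u S
    using has_derivative_at_withinI[OF has_derivative_grad[OF R(1)], of u S] by (simp add: R(2))
  have Dg: "(grad \<eta> has_derivative (\<lambda>v. hess \<eta> u *v v)) (at u within S)" for u S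
    by (rule has_derivative_at_withinI[OF has_derivative_hess[OF \<eta>]])
  have DF: "(F has_derivative (\<lambda>v. J u *v v)) (at u within S)" for u S
    unfolding J_def
    by (rule has_derivative_at_withinI[OF iffD1[OF jacobian_works smooth_on_UNIV_differentiable[OF F]]])
  note chain = vector_derivative_diff_chain_within[unfolded o_def]

  define P where "P x s = \<eta> (u x s) + \<epsilon> * (grad \<eta> (u x s) \<bullet> W x s)
    + \<alpha> * \<epsilon>\<^sup>2 / 2 * (W x s \<bullet> W x s + V x s \<bullet> (A *v V x s)) + \<alpha> * \<epsilon> * R (u x s)" for x s
  define Pt where "Pt x s = grad \<eta> (u x s) \<bullet> W x s
    + \<epsilon> * (grad \<eta> (u x s) \<bullet> Z x s + (hess \<eta> (u x s) *v W x s) \<bullet> W x s)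
    + \<alpha> * \<epsilon>\<^sup>2 / 2 * ((W x s \<bullet> Z x s + Z x s \<bullet> W x s)
      + (V x s \<bullet> (A *v m x s) + m x s \<bullet> (A *v V x s)))
    + \<alpha> * \<epsilon> * - (G (u x s) \<bullet> W x s)" for x s
  \<comment> \<open>Subtracting \<open>q 0\<close> makes the flux vanish at the zero state, hence at
    infinity, without normalising \<open>q\<close>.\<close>
  define Q where "Q x s = q (u x s) - \<epsilon> * (grad \<eta> (u x s) \<bullet> (A *v V x s))
    - \<alpha> * \<epsilon>\<^sup>2 * (W x s \<bullet> (A *v V x s)) - q 0" for x s
  define Qx where "Qx x s = grad \<eta> (u x s) \<bullet> (J (u x s) *v V x s)
    - \<epsilon> * (grad \<eta> (u x s) \<bullet> (A *v p x s) + (hess \<eta> (u x s) *v V x s) \<bullet> (A *v V x s))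
    - \<alpha> * \<epsilon>\<^sup>2 * (W x s \<bullet> (A *v p x s) + m x s \<bullet> (A *v V x s))" for x s

  have P_deriv: "((\<lambda>s. P x s) has_real_derivative Pt x s) (at s within {0..T})"
    if s: "s \<in> {0..T}" for x s
  proof -
    have "((\<lambda>s. \<eta> (u x s)) has_real_derivative grad \<eta> (u x s) \<bullet> W x s) (at s within {0..T})"
      "((\<lambda>s. R (u x s)) has_real_derivative - (G (u x s) \<bullet> W x s)) (at s within {0..T})"
      unfolding has_real_derivative_iff_has_vector_derivative
      by (rule chain[OF ut[OF s] D\<eta>] chain[OF ut[OF s] DR])+
    moreover note has_vector_derivative_inner[OF chain[OF ut[OF s] Dg] Wt[OF s]]
      has_vector_derivative_inner[OF Wt[OF s] Wt[OF s]]
      has_vector_derivative_inner[OF Vt[OF s] has_vector_derivative_matrix_vector_mult[OF Vt[OF s]]]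
    ultimately show ?thesis
      unfolding P_def Pt_def by (intro DERIV_add DERIV_cmult)
  qed
  have Q_deriv: "((\<lambda>y. Q y s) has_real_derivative Qx x s) (at x)" if s: "s \<in> {0..T}" for x s
  proof -
    note AV = has_vector_derivative_matrix_vector_mult[OF Vx[OF s]]
    have "((\<lambda>y. q (u y s)) has_real_derivative grad \<eta> (u x s) \<bullet> (J (u x s) *v V x s)) (at x)"
      unfolding has_real_derivative_iff_has_vector_derivative by (rule chain[OF ux[OF s] Dq])
    from DERIV_diff[OF DERIV_diff[OF DERIV_diff[OF this
          DERIV_cmult[OF has_vector_derivative_inner[OF chain[OF ux[OF s] Dg] AV]]]
        DERIV_cmult[OF has_vector_derivative_inner[OF Wx[OF s] AV]]] DERIV_const]
    show ?thesis unfolding Q_def Qx_def by simp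
  qed

  have cont: "continuous_on ?S (\<lambda>z. u (fst z) (snd z))" "continuous_on ?S (\<lambda>z. V (fst z) (snd z))"
    "continuous_on ?S (\<lambda>z. W (fst z) (snd z))" "continuous_on ?S (\<lambda>z. Z (fst z) (snd z))"
    "continuous_on ?S (\<lambda>z. m (fst z) (snd z))" "continuous_on ?S (\<lambda>z. p (fst z) (snd z))"
    using su sV sW sZ sm sp by (auto dest!: smooth_on_continuous_on simp: case_prod_beta)
  have cR: "continuous_on UNIV R"
    using R(1) differentiable_imp_continuous_within by (auto simp: continuous_on_eq_continuous_within)
  have compose: "continuous_on ?S (\<lambda>z. h (u (fst z) (snd z)))"
    if "continuous_on UNIV h" for h :: "real ^ 'n \<Rightarrow> 'b::topological_space"
    using continuous_on_compose2[OF that cont(1)] by auto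
  have cJ: "continuous_on UNIV J" unfolding J_def by (rule continuous_on_jacobian[OF F])
  note contu = compose[OF continuous_on_grad[OF \<eta>]] compose[OF continuous_on_hess[OF \<eta>]]
    compose[OF G(1)] compose[OF cJ]
    compose[OF smooth_on_continuous_on[OF \<eta>]] compose[OF cR]
  have cP: "continuous_on ?S (\<lambda>(x, s). P x s)"
    unfolding P_def case_prod_beta
    by (intro continuous_intros continuous_on_matrix_vector_mult cont contu)
  have cPt: "continuous_on ?S (\<lambda>(x, s). Pt x s)"
    unfolding Pt_def case_prod_beta
    by (intro continuous_intros continuous_on_matrix_vector_mult cont contu)
  have cQx: "continuous_on ?S (\<lambda>(x, s). Qx x s)"
    unfolding Qx_def case_prod_beta
    by (intro continuous_intros continuous_on_matrix_vector_mult cont contu)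
  have ck: "continuous_on ?S (\<lambda>(x, s). k x s)"
    unfolding k_def case_prod_beta by (intro continuous_intros cont contu)

  have balance: "Pt x s + Qx x s \<le> - k x s" if s: "s \<in> {0..T}" for x s
  proof -
    let ?u = "u x s"
    have Fx: "D_x (\<lambda>y s. F (u y s)) x s = J ?u *v V x s"
      unfolding D_x_def by (rule vector_derivative_at[OF chain[OF ux[OF s] DF]])
    have pde: "W x s + J ?u *v V x s = G ?u + \<epsilon> *\<^sub>R (A *v p x s - Z x s)"
      using bspec[OF spec[OF conjunct2[OF sol[unfolded smooth_solution_def]], of x] s]
      unfolding p_def Z_def V_def W_def Fx .
    have H: "W x s \<bullet> (hess \<eta> ?u *v W x s) \<le> \<alpha> / 2 * (norm (W x s))\<^sup>2"
      using Hu[of ?u] unfolding qform_le_def qform_mat by blast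
    have sc: "\<alpha> * (norm (J ?u *v V x s))\<^sup>2 \<le> (hess \<eta> ?u *v V x s) \<bullet> (A *v V x s)"
    proof -
      let ?v = "V x s" and ?H = "hess \<eta> ?u" and ?J = "J ?u"
      have A': "x \<bullet> (A *v y) = (A *v x) \<bullet> y" for x y
        using dot_lmul_matrix[of x A y] symA vector_transpose_matrix[of x A] by simp
      have "\<nu> * (norm ?v)\<^sup>2 \<le> ?v \<bullet> (((1/2) *\<^sub>R (A ** ?H + ?H ** A)
          - \<alpha> *\<^sub>R (transpose ?J ** ?J)) *v ?v)"
        using sub(2) unfolding subcharacteristic_def qform_le_def qform_mat J_def by blast
      also have "\<dots> = 1 / 2 * (?v \<bullet> (A *v (?H *v ?v)) + ?v \<bullet> (?H *v (A *v ?v)))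
          - \<alpha> * (?v \<bullet> (transpose ?J *v (?J *v ?v)))"
        by (simp add: matrix_vector_mult_diff_rdistrib matrix_vector_mult_add_rdistrib
            scaleR_matrix_vector_assoc[symmetric] matrix_vector_mul_assoc[symmetric]
            inner_diff_right inner_add_right)
      \<comment> \<open>By symmetry of \<open>A\<close> and of the Hessian, both halves of the
        symmetrised product give the same number Hv.Av.\<close>
      also have "?v \<bullet> (A *v (?H *v ?v)) = (?H *v ?v) \<bullet> (A *v ?v)"
        by (simp add: A' inner_commute)
      also have "?v \<bullet> (?H *v (A *v ?v)) = (?H *v ?v) \<bullet> (A *v ?v)"
        using hess_symmetric[OF \<eta>] by (simp add: inner_commute)
      also have "?v \<bullet> (transpose ?J *v (?J *v ?v)) = (norm (?J *v ?v))\<^sup>2"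
        by (metis dot_lmul_matrix vector_transpose_matrix power2_norm_eq_inner transpose_transpose)
      finally have "\<nu> * (norm ?v)\<^sup>2 \<le> (?H *v ?v) \<bullet> (A *v ?v) - \<alpha> * (norm (?J *v ?v))\<^sup>2"
        by simp
      moreover have "0 \<le> \<nu> * (norm ?v)\<^sup>2" using sub(1) by simp
      ultimately show ?thesis by linarith
    qed
    have "Pt x s + Qx x s \<le> grad \<eta> ?u \<bullet> G ?u"
      unfolding Pt_def Qx_def by (rule dissipation_inequality[OF symA pde H sc pos(2,3)])
    \<comment> \<open>Weak dissipation is compared with the zero state, where the entropy gradient
      and \<open>G\<close> vanish; thus the right-hand side is exactly
      \<open>- k x s\<close>.\<close>
    moreover have "grad \<eta> ?u \<bullet> G ?u \<le> 0"
      using dis[unfolded weakly_dissipative_def, rule_format, of ?u 0] \<eta>0 G(2) by simp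
    ultimately show ?thesis by (simp add: k_def)
  qed

  have lim: "uniform_limit {0..T} Q (\<lambda>_. 0) at_infinity"
  proof -
    have ul: "uniform_limit {0..T} ((D_x ^^ i) ((D_t T ^^ j) u)) (\<lambda>_. 0) at_infinity" for i j
      using dec unfolding decays_fast_def by blast
    have "uniform_limit {0..T} u (\<lambda>_. 0) at_infinity" "uniform_limit {0..T} V (\<lambda>_. 0) at_infinity"
      "uniform_limit {0..T} W (\<lambda>_. 0) at_infinity"
      using ul[of 0 0] ul[of 1 0] ul[of 0 1] by (simp_all add: V_def W_def)
    then have ul3: "uniform_limit {0..T} (\<lambda>x s. (u x s, V x s, W x s)) (\<lambda>_. 0) at_infinity"
      using uniform_limit_Pair_0[OF _ uniform_limit_Pair_0] by (simp add: zero_prod_def)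
    let ?\<Phi> = "\<lambda>z. q (fst z) - \<epsilon> * (grad \<eta> (fst z) \<bullet> (A *v fst (snd z)))
      - \<alpha> * \<epsilon>\<^sup>2 * (snd (snd z) \<bullet> (A *v fst (snd z))) - q 0"
    have "continuous_on UNIV ?\<Phi>"
      by (intro continuous_intros continuous_on_matrix_vector_mult
          continuous_on_compose2[OF continuous_on_grad[OF \<eta>]]
          continuous_on_compose2[OF smooth_on_continuous_on[OF q]]) auto
    then have "isCont ?\<Phi> 0"
      using continuous_on_eq_continuous_at open_UNIV by blast
    from uniform_limit_isCont_0[OF this ul3] show ?thesis
      by (simp add: Q_def[abs_def])
  qed

  let ?E = "energy_density T \<epsilon> u"
  have bounds: "c * ?E x s + \<alpha> * \<epsilon> * R (u x s) \<le> P x s"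
    "P x s \<le> \<alpha> * (1 + L) * ?E x s + \<alpha> * \<epsilon> * R (u x s)" for x s
  proof -
    have "(norm (grad \<eta> (u x s)))\<^sup>2 \<le> \<alpha> * \<eta> (u x s)"
      using square_grad_le[OF \<eta> Hu _ \<eta>_nonneg, of "u x s"] pos(2) by simp
    moreover have "\<beta> / 2 * (norm (u x s))\<^sup>2 \<le> \<eta> (u x s)" "\<eta> (u x s) \<le> \<alpha> / 4 * (norm (u x s))\<^sup>2"
      using entropy_quadratic_bounds[OF \<eta> Hl Hu \<eta>0, of "u x s"] by simp_all
    ultimately show "c * ?E x s + \<alpha> * \<epsilon> * R (u x s) \<le> P x s"
      "P x s \<le> \<alpha> * (1 + L) * ?E x s + \<alpha> * \<epsilon> * R (u x s)"
      using energy_density_equivalence[OF pos(2,1), of "grad \<eta> (u x s)" "\<eta> (u x s)" \<beta> "u x s" l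
          "V x s" "V x s \<bullet> (A *v V x s)" \<epsilon> "W x s"] A
      unfolding P_def c_def energy_density_def V_def W_def by simp_all
  qed
  have iE: "integrable lborel (\<lambda>x. ?E x s)" and iR: "integrable lborel (\<lambda>x. R (u x s))"
    and ik: "integrable lborel (\<lambda>x. k x s)" if "s \<in> {0..T}" for s
    using dec that unfolding decays_fast_def differentiable_under_integral_def k_def by auto
  have iP: "integrable lborel (\<lambda>x. P x s)" if s: "s \<in> {0..T}" for s
  proof (rule Bochner_Integration.integrable_bound)
    \<comment> \<open>The two-sided bounds on \<open>P\<close> give an integrable majorant; |c|
      appears because neither \<beta> nor \<open>l\<close> is assumed positive here.\<close>
    show "integrable lborel (\<lambda>x. (\<bar>c\<bar> + \<alpha> * (1 + L)) * ?E x s + \<alpha> * \<epsilon> * R (u x s))"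
      using iE[OF s] iR[OF s] by simp
    have "continuous_on UNIV (\<lambda>x. P x s)" by (rule continuous_on_slices(1)[OF cP s])
    then show "(\<lambda>x. P x s) \<in> borel_measurable lborel"
      by (simp add: borel_measurable_continuous_onI)
    show "AE x in lborel. norm (P x s) \<le> norm ((\<bar>c\<bar> + \<alpha> * (1 + L)) * ?E x s + \<alpha> * \<epsilon> * R (u x s))"
    proof (rule AE_I2)
      fix x
      have E: "0 \<le> ?E x s" by (simp add: energy_density_def)
      have R': "0 \<le> \<alpha> * \<epsilon> * R (u x s)" using R(3) pos by simp
      have cE: "- (\<bar>c\<bar> * ?E x s) \<le> c * ?E x s" "0 \<le> \<bar>c\<bar> * ?E x s" "0 \<le> \<alpha> * (1 + L) * ?E x s"
        using E pos mult_right_mono[of "- \<bar>c\<bar>" c "?E x s"] by simp_all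
      show "norm (P x s) \<le> norm ((\<bar>c\<bar> + \<alpha> * (1 + L)) * ?E x s + \<alpha> * \<epsilon> * R (u x s))"
        using bounds[of x s] cE R' unfolding distrib_right real_norm_def by linarith
    qed
  qed
  have t0: "0 \<in> {0..T}" "0 \<le> t" "{0..t} \<subseteq> {0..T}" using t pos by auto
  have sub_t: "UNIV \<times> {0..t} \<subseteq> ?S" using t0 by blast
  have main: "set_integrable lborel {0..t} (\<lambda>s. LINT x|lborel. k x s) \<and>
    (LINT x|lborel. P x t) + (LINT s:{0..t}|lborel. LINT x|lborel. k x s) \<le> (LINT x|lborel. P x 0)"
  proof (rule balance_law_on_line[of t P Pt Q Qx k])
    show "((\<lambda>s. P x s) has_real_derivative Pt x s) (at s within {0..t})" if "s \<in> {0..t}" for x s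
      using has_field_derivative_subset[OF P_deriv t0(3)] that t0(3) by blast
    show "uniform_limit {0..t} Q (\<lambda>_. 0) at_infinity"
      by (rule uniform_limit_on_subset[OF lim t0(3)])
    show "((\<lambda>y. Q y s) has_real_derivative Qx x s) (at x)" "Pt x s + Qx x s \<le> - k x s"
      "integrable lborel (\<lambda>x. k x s)" if "s \<in> {0..t}" for x s
      using that t0(3) Q_deriv balance ik by blast+
    show "0 \<le> k x s" for x s by (simp add: k_def)
  qed (use t0(2) iP[OF t0(1)] iP[OF t] continuous_on_subset[OF cPt sub_t]
      continuous_on_subset[OF cQx sub_t] continuous_on_subset[OF ck sub_t] in auto)
  have "c * energy T \<epsilon> u t + \<alpha> * \<epsilon> * (LINT x|lborel. R (u x t)) =
      (LINT x|lborel. c * ?E x t + \<alpha> * \<epsilon> * R (u x t))"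
    using iE[OF t] iR[OF t] by (simp add: energy_def)
  also have "\<dots> \<le> (LINT x|lborel. P x t)"
    using iE[OF t] iR[OF t] iP[OF t] bounds by (intro integral_mono) auto
  finally have 1: "c * energy T \<epsilon> u t + \<alpha> * \<epsilon> * (LINT x|lborel. R (u x t)) \<le> (LINT x|lborel. P x t)" .
  have "(LINT x|lborel. P x 0) \<le> (LINT x|lborel. \<alpha> * (1 + L) * ?E x 0 + \<alpha> * \<epsilon> * R (u x 0))"
    using iE[OF t0(1)] iR[OF t0(1)] iP[OF t0(1)] bounds by (intro integral_mono) auto
  also have "\<dots> = \<alpha> * (1 + L) * energy T \<epsilon> u 0 + \<alpha> * \<epsilon> * (LINT x|lborel. R (u x 0))"
    using iE[OF t0(1)] iR[OF t0(1)] by (simp add: energy_def)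
  finally show ?thesis using main 1 by linarith
qed

section \<open>Choice of the constant\<close>

text \<open>Integrability in time accompanies the bound because the integral of a nonintegrable
  function is 0 by default, which would empty the estimate of content.\<close>

theorem proposition3p1p2:
  fixes A :: "real ^ 'n ^ 'n" and \<alpha> \<beta> :: real
  assumes "sym_pos_def A" and "\<alpha> > 0" and "\<beta> > 0"
  shows "\<exists>C>0. \<forall>(F :: real ^ 'n \<Rightarrow> real ^ 'n) (G :: real ^ 'n \<Rightarrow> real ^ 'n)
           (\<eta> :: real ^ 'n \<Rightarrow> real) (q :: real ^ 'n \<Rightarrow> real) (R :: real ^ 'n \<Rightarrow> real)
           (\<nu> :: real) (C_R :: real) (T :: real) (u :: real \<Rightarrow> real \<Rightarrow> real \<Rightarrow> real ^ 'n).
      smooth_on F UNIV \<longrightarrow> continuous_on UNIV G \<longrightarrow> G 0 = 0 \<longrightarrow> T > 0 \<longrightarrow>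
      (\<forall>\<epsilon>>0. smooth_solution T A F G \<epsilon> (u \<epsilon>) \<and> decays_fast T \<eta> G R \<epsilon> (u \<epsilon>)) \<longrightarrow>
      entropy_pair \<alpha> \<beta> F \<eta> q \<longrightarrow>
      \<nu> > 0 \<longrightarrow> subcharacteristic A \<alpha> \<nu> F \<eta> \<longrightarrow>
      weakly_dissipative G \<eta> \<longrightarrow>
      source_potential C_R G R \<longrightarrow>
      (\<forall>\<epsilon>>0. \<forall>t\<in>{0..T}.
         set_integrable lborel {0..t}
           (\<lambda>s. LINT x|lborel. \<bar>grad \<eta> (u \<epsilon> x s) \<bullet> G (u \<epsilon> x s)\<bar>) \<and>
         energy T \<epsilon> (u \<epsilon>) t + \<epsilon> * (LINT x|lborel. R (u \<epsilon> x t))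
           + (LINT s:{0..t}|lborel. LINT x|lborel. \<bar>grad \<eta> (u \<epsilon> x s) \<bullet> G (u \<epsilon> x s)\<bar>)
         \<le> C * (energy T \<epsilon> (u \<epsilon>) 0 + \<epsilon> * (LINT x|lborel. R (u \<epsilon> x 0))))"
proof -
  obtain l L where lL: "l > 0" "L > 0" "\<And>v. l * (norm v)\<^sup>2 \<le> v \<bullet> (A *v v)"
    "\<And>v. v \<bullet> (A *v v) \<le> L * (norm v)\<^sup>2"
    using sym_pos_def_bounds[OF assms(1)] by blast
  have symA: "transpose A = A" using assms(1) unfolding sym_pos_def_def by blast
  define c where "c = min (\<beta> / 6) (min (\<alpha> / 8) (\<alpha> * l / 2))"
  \<comment> \<open>\<open>c1\<close> lies below the three coefficients on the left: 1 for the
    dissipation, \<open>c\<close> for the energy, \<alpha> for the source potential.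
    \<open>c2\<close> dominates both coefficients on the right, as \<alpha> \<le> \<alpha> (1 + L);
    division gives \<open>C = c2 / c1\<close>.\<close>
  define c1 where "c1 = min 1 (min c \<alpha>)"
  define c2 where "c2 = \<alpha> * (1 + L)"
  have "c > 0" unfolding c_def using assms lL by simp
  then have c1: "c1 > 0" "c1 \<le> 1" "c1 \<le> c" "c1 \<le> \<alpha>" unfolding c1_def using assms by auto
  have c2: "c2 > 0" "\<alpha> \<le> c2" using assms lL by (simp_all add: c2_def distrib_left add_pos_pos)
  show ?thesis
  proof (rule exI[of _ "c2 / c1"], rule conjI, goal_cases)
    case 1
    show ?case using c1 c2 by simp
  next
    case 2
    show ?case
    proof (intro allI impI ballI, goal_cases)
      case (1 F G \<eta> q R \<nu> C_R T u \<epsilon> t)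
      let ?k = "\<lambda>x s. \<bar>grad \<eta> (u \<epsilon> x s) \<bullet> G (u \<epsilon> x s)\<bar>"
      let ?R = "\<lambda>s. LINT x|lborel. R (u \<epsilon> x s)"
      let ?K = "LINT s:{0..t}|lborel. LINT x|lborel. ?k x s"
      have sol: "smooth_solution T A F G \<epsilon> (u \<epsilon>)" "decays_fast T \<eta> G R \<epsilon> (u \<epsilon>)" using 1 by blast+
      have est: "set_integrable lborel {0..t} (\<lambda>s. LINT x|lborel. ?k x s)"
        "c * energy T \<epsilon> (u \<epsilon>) t + \<alpha> * \<epsilon> * ?R t + ?K
          \<le> c2 * energy T \<epsilon> (u \<epsilon>) 0 + \<alpha> * \<epsilon> * ?R 0"
        using energy_estimate[OF symA lL(3,4,2) assms(2) 1(11) 1(4) 1(1-3) sol 1(6-10) 1(12)]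
        unfolding c_def c2_def by blast+
      have E: "0 \<le> energy T \<epsilon> (u \<epsilon>) s" for s
        unfolding energy_def energy_density_def by (intro Bochner_Integration.integral_nonneg) simp
      have R: "0 \<le> \<epsilon> * ?R s" for s
        using 1(10,11) unfolding source_potential_def by (auto intro!: mult_nonneg_nonneg Bochner_Integration.integral_nonneg)
      have K: "0 \<le> ?K"
        unfolding set_lebesgue_integral_def by (intro Bochner_Integration.integral_nonneg) (simp add: Bochner_Integration.integral_nonneg)
      have "c1 * (energy T \<epsilon> (u \<epsilon>) t + \<epsilon> * ?R t + ?K)
          = c1 * energy T \<epsilon> (u \<epsilon>) t + c1 * (\<epsilon> * ?R t) + c1 * ?K"
        by (simp add: algebra_simps)
      also have "\<dots> \<le> c * energy T \<epsilon> (u \<epsilon>) t + \<alpha> * (\<epsilon> * ?R t) + 1 * ?K"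
        using c1 by (intro add_mono mult_right_mono E R K)
      also have "\<dots> \<le> c2 * energy T \<epsilon> (u \<epsilon>) 0 + \<alpha> * (\<epsilon> * ?R 0)"
        using est(2) by (simp add: mult.assoc)
      also have "\<dots> \<le> c2 * energy T \<epsilon> (u \<epsilon>) 0 + c2 * (\<epsilon> * ?R 0)"
        using c2 by (intro add_left_mono mult_right_mono R)
      finally have "energy T \<epsilon> (u \<epsilon>) t + \<epsilon> * ?R t + ?K
          \<le> c2 / c1 * (energy T \<epsilon> (u \<epsilon>) 0 + \<epsilon> * ?R 0)"
        using c1 by (simp add: field_simps)
      with est(1) show ?case by blast
    qed
  qed
qed

end
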